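(* Let $q\ge 4$ and let $H_1$ be a hyperplane of $\mathrm{PG}(U_1)$ with $|H_1\cap\mathcal O_1|=q^2-q+1$. Then $H_1\cap\mathcal O_1$ is a $(6,4)$-set of $H_1\cong\mathrm{PG}(6,q)$.
   Context: $q$ is a prime power. Let $U_1\subset\mathbb F_{q^3}^8$ be the set of vectors $(a,b^{q^2},b^{q},c,b,c^{q},c^{q^2},d)$ with $a,d\in\mathbb F_q$, $b,c\in\mathbb F_{q^3}$; it is an $8$-dimensional $\mathbb F_q$-vector space, so $\mathrm{PG}(U_1)\cong\mathrm{PG}(7,q)$. For $(a,b,c,d)\ne 0$ let $P(a,b,c,d)$ be the point of $\mathrm{PG}(U_1)$ spanned by this vector. Let $\mathcal O_1=\{P(1,t,t^{q^2+q},t^{q^2+q+1}) : t\in\mathbb F_{q^3}\}\cup\{P(0,0,0,1)\}$. For integers $r,s$, an $(r,s)$-set of $\mathrm{PG}(n,q)$ is a set $\mathcal X$ of points such that: (i) every $s$-dimensional projective subspace contains at most $r$ points of $\mathcal X$; (ii) $\mathcal X$ spans $\mathrm{PG}(n,q)$; (iii) some $(s+1)$-dimensional projective subspace contains $r+2$ points of $\mathcal X$. *)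

theory Defs
  imports "HOL-Computational_Algebra.Primes"
begin

text \<open>Ambient setting: a finite field 'a of order q^3 (playing F_{q^3});
 vectors of F_{q^3}^8 are functions nat => 'a (only coordinates 0..7 are used,
 the others are 0).  F_q is the subfield {x. x^q = x}.\<close>

definition Fq :: "nat \<Rightarrow> 'a::{finite,field} set" where
  "Fq q = {x. x ^ q = x}"

definition u1vec :: "nat \<Rightarrow> 'a::{finite,field} \<Rightarrow> 'a \<Rightarrow> 'a \<Rightarrow> 'a \<Rightarrow> nat \<Rightarrow> 'a" where
  "u1vec q a b c d = (\<lambda>i. if i = 0 then a else if i = 1 then b ^ (q^2)
     else if i = 2 then b ^ q else if i = 3 then c else if i = 4 then b
     else if i = 5 then c ^ q else if i = 6 then c ^ (q^2) else if i = 7 then d else 0)"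

definition U1 :: "nat \<Rightarrow> (nat \<Rightarrow> 'a::{finite,field}) set" where
  "U1 q = {u1vec q a b c d | a b c d. a \<in> Fq q \<and> d \<in> Fq q}"

definition fq_span :: "nat \<Rightarrow> (nat \<Rightarrow> 'a::{finite,field}) list \<Rightarrow> (nat \<Rightarrow> 'a) set" where
  "fq_span q vs = {(\<lambda>i. \<Sum>j<length vs. cs j * (vs ! j) i) | cs. \<forall>j. cs j \<in> Fq q}"

definition fq_indep :: "nat \<Rightarrow> (nat \<Rightarrow> 'a::{finite,field}) list \<Rightarrow> bool" where
  "fq_indep q vs \<longleftrightarrow> (\<forall>cs. (\<forall>j. cs j \<in> Fq q) \<longrightarrow>
      (\<lambda>i. \<Sum>j<length vs. cs j * (vs ! j) i) = (\<lambda>_. 0) \<longrightarrow> (\<forall>j<length vs. cs j = 0))"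

definition fq_subspace_dim :: "nat \<Rightarrow> (nat \<Rightarrow> 'a::{finite,field}) set \<Rightarrow> nat \<Rightarrow> bool" where
  "fq_subspace_dim q W k \<longleftrightarrow>
     (\<exists>vs. length vs = k \<and> set vs \<subseteq> W \<and> fq_indep q vs \<and> fq_span q vs = W)"

definition Pt :: "nat \<Rightarrow> 'a::{finite,field} \<Rightarrow> 'a \<Rightarrow> 'a \<Rightarrow> 'a \<Rightarrow> (nat \<Rightarrow> 'a) set" where
  "Pt q a b c d = fq_span q [u1vec q a b c d]"

definition O1 :: "nat \<Rightarrow> (nat \<Rightarrow> 'a::{finite,field}) set set" where
  "O1 q = {Pt q 1 t (t ^ (q^2 + q)) (t ^ (q^2 + q + 1)) | t. True} \<union> {Pt q 0 0 0 1}"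

definition pts_in :: "(nat \<Rightarrow> 'a) set set \<Rightarrow> (nat \<Rightarrow> 'a) set \<Rightarrow> (nat \<Rightarrow> 'a) set set" where
  "pts_in X W = {P \<in> X. P \<subseteq> W}"

text \<open>(r,s)-set of the projective space PG(V) (V an F_q-vector space of dimension n+1,
  here given as a subspace of U1; projective s-subspaces = vector subspaces of dimension s+1).\<close>
definition rs_set :: "nat \<Rightarrow> nat \<Rightarrow> nat \<Rightarrow> (nat \<Rightarrow> 'a::{finite,field}) set
     \<Rightarrow> (nat \<Rightarrow> 'a) set set \<Rightarrow> bool" where
  "rs_set q r s V X \<longleftrightarrow>
     (\<forall>W. W \<subseteq> V \<and> fq_subspace_dim q W (s + 1) \<longrightarrow> card (pts_in X W) \<le> r) \<and>
     (\<exists>vs. set vs \<subseteq> \<Union>X \<and> fq_span q vs = V) \<and>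
     (\<exists>W. W \<subseteq> V \<and> fq_subspace_dim q W (s + 2) \<and> card (pts_in X W) \<ge> r + 2)"

end

theory Submission
  imports Defs "HOL-Algebra.Algebraic_Closure_Type" "HOL-Library.Product_Plus"
begin

hide_const (open) Divisibility.prime

text \<open>
  A hyperplane is the kernel of a functional, whose value at the point with parameter \<open>t\<close> is
  \<open>T(t, t\<^sup>q, t\<^bsup>q\<^sup>2\<^esup>)\<close> for a trilinear form \<open>T\<close>. The Hessian of \<open>T\<close> is a quadratic
  polynomial over the field of order \<open>q\<^sup>3\<close>. If it has a root on the projective line over that field,
  a change of parameter turns the functional into \<open>N(t) - c\<close> or \<open>A + Tr(B t)\<close>, and it never has
  \<open>q\<^sup>2 - q + 1\<close> zeros. Otherwise its two conjugate roots yield a coordinate \<open>z\<close> on the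
  projective line which identifies the zeros of the functional with the roots of unity of order
  \<open>q\<^sup>2 - q + 1\<close>. There \<open>z\<^bsup>q\<^sup>2\<^esup> = z\<^sup>q / z\<close>, and every functional takes the form
  \<open>\<gamma> + Tr(\<beta> z)\<close> up to a factor, where \<open>Tr\<close> is the trace from the field of order \<open>q\<^sup>6\<close>.
  In terms of \<open>u = z\<close> and \<open>v = z\<^sup>q\<close> this is a quadratic in \<open>v\<close>; eliminating \<open>v\<close> from two
  such equations leaves a polynomial of degree 6 in \<open>u\<close>, which bounds the points in a subspace.
  The points span because a single equation has degree \<open>2 q + 1 < q\<^sup>2 - q + 1\<close> in \<open>z\<close>.
  A subspace with eight points is found by counting if \<open>q \<ge> 5\<close>, and explicitly if \<open>q = 4\<close>.
\<close>

section \<open>Counting by fibres, and solutions of power equations\<close>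

lemma card_le_fibres:
  assumes "finite B" and "\<And>a. a \<in> A \<Longrightarrow> f a \<in> B"
    and "\<And>b. b \<in> B \<Longrightarrow> finite {a \<in> A. f a = b} \<and> card {a \<in> A. f a = b} \<le> m"
  shows "finite A" and "card A \<le> m * card B"
proof -
  have A: "A = (\<Union>b\<in>B. {a \<in> A. f a = b})"
    using assms(2) by auto
  show "finite A"
    by (subst A) (use assms in auto)
  have "card A \<le> (\<Sum>b\<in>B. card {a \<in> A. f a = b})"
    by (subst A, rule card_UN_le, fact)
  also have "\<dots> \<le> (\<Sum>b\<in>B. m)"
    using assms(3) by (intro sum_mono) auto
  finally show "card A \<le> m * card B"
    by (simp add: mult.commute)
qed

lemma card_power_eq:
  fixes c :: "'b::idom"
  assumes "0 < n"
  shows "finite {x. x ^ n = c}" and "card {x. x ^ n = c} \<le> n"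
proof -
  define p where "p = monom 1 n + [:- c:]"
  have deg: "degree p = n"
    using assms degree_add_eq_left[of "[:- c:]" "monom 1 n"] unfolding p_def
    by (simp add: degree_monom_eq)
  then have "p \<noteq> 0"
    using assms by auto
  moreover have "{x. x ^ n = c} = {x. poly p x = 0}"
    by (auto simp: p_def poly_monom)
  ultimately show "finite {x. x ^ n = c}" and "card {x. x ^ n = c} \<le> n"
    using poly_roots_finite[of p] card_poly_roots_bound[of p] deg by auto
qed

lemma card_power_eq_self:
  assumes "1 < n"
  shows "finite {x :: 'b::idom. x ^ n = x}" and "card {x :: 'b. x ^ n = x} \<le> n"
proof -
  define p :: "'b poly" where "p = monom 1 n + [:0, - 1:]"
  have deg: "degree p = n"
    using assms degree_add_eq_left[of "[:0, - 1 :: 'b:]" "monom 1 n"] unfolding p_def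
    by (simp add: degree_monom_eq)
  then have "p \<noteq> 0"
    using assms by auto
  moreover have "{x. x ^ n = x} = {x. poly p x = 0}"
    by (auto simp: p_def poly_monom)
  ultimately show "finite {x :: 'b. x ^ n = x}" and "card {x :: 'b. x ^ n = x} \<le> n"
    using poly_roots_finite[of p] card_poly_roots_bound[of p] deg by auto
qed

text \<open>Subtracting one of its elements moves any nonempty fibre of \<open>f\<close> injectively
  into the zero fibre. The subtraction is a parameter \<open>d\<close>, so that field elements,
  tuples and pointwise vectors are covered alike.\<close>

lemma card_le_kernel:
  assumes "finite A" and "finite B" and "\<And>a. a \<in> A \<Longrightarrow> f a \<in> B"
    and "\<And>a b. a \<in> A \<Longrightarrow> b \<in> A \<Longrightarrow> f a = f b \<Longrightarrow> d a b \<in> A \<and> f (d a b) = 0"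
    and "\<And>b. inj_on (\<lambda>a. d a b) A"
  shows "card A \<le> card {a \<in> A. f a = 0} * card B"
proof (rule card_le_fibres(2)[OF assms(2,3)])
  fix b
  have "card {a \<in> A. f a = b} \<le> card {a \<in> A. f a = 0}"
  proof (cases "{a \<in> A. f a = b} = {}")
    case False
    then obtain a0 where a0: "a0 \<in> A" "f a0 = b"
      by blast
    show ?thesis
    proof (rule card_inj_on_le)
      show "inj_on (\<lambda>a. d a a0) {a \<in> A. f a = b}"
        by (rule inj_on_subset[OF assms(5)]) auto
      show "(\<lambda>a. d a a0) ` {a \<in> A. f a = b} \<subseteq> {a \<in> A. f a = 0}"
        using assms(4) a0 by auto
    qed (use assms(1) in auto)
  qed (simp only: card.empty le0)
  then show "finite {a \<in> A. f a = b} \<and> card {a \<in> A. f a = b} \<le> card {a \<in> A. f a = 0}"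
    using assms(1) by auto
qed auto

section \<open>Polynomial identities behind the changes of coordinates\<close>

definition scale4 :: "'a::times \<Rightarrow> 'a \<times> 'a \<times> 'a \<times> 'a \<Rightarrow> 'a \<times> 'a \<times> 'a \<times> 'a" where
  "scale4 l g = (case g of (A, B, C, D) \<Rightarrow> (l * A, l * B, l * C, l * D))"

lemma scale4_simp [simp]: "scale4 l (A, B, C, D) = (l * A, l * B, l * C, l * D)"
  by (simp add: scale4_def)

text \<open>The left side is the leading coefficient of the Hessian of the functional transformed by
  \<open>t = e + 1/s\<close>, the right side the old Hessian at \<open>e\<close>. A root
  \<open>e\<close> is thus sent to infinity. Indexed letters stand for conjugates.\<close>

lemma hessian_shift_identity:
  fixes e :: "'b::comm_ring_1"
  shows "(C + D * e) * (A + B * e + B1 * e1 + B2 * e2 + C * e1 * e2 + C1 * e2 * e + C2 * e * e1 + D * e * e1 * e2)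
     - (B1 + C2 * e + C * e2 + D * e2 * e) * (B2 + C * e1 + C1 * e + D * e * e1)
   = (A + B * e) * (C + D * e) - (B1 + C2 * e) * (B2 + C1 * e)"
  by (simp add: algebra_simps)

text \<open>The substitution \<open>t = e + 1/s\<close> in a functional, with denominators cleared
  by the norm \<open>s * s1 * s2\<close>.\<close>

lemma inversion_identity:
  fixes s :: "'b::field"
  assumes "s \<noteq> 0" "s1 \<noteq> 0" "s2 \<noteq> 0"
  shows "s * s1 * s2 * (A + B * (e + 1 / s) + B1 * (e1 + 1 / s1) + B2 * (e2 + 1 / s2)
      + C * (e1 + 1 / s1) * (e2 + 1 / s2) + C1 * (e2 + 1 / s2) * (e + 1 / s)
      + C2 * (e + 1 / s) * (e1 + 1 / s1) + D * (e + 1 / s) * (e1 + 1 / s1) * (e2 + 1 / s2))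
    = D + (C + D * e) * s + (C1 + D * e1) * s1 + (C2 + D * e2) * s2
      + (B + C1 * e2 + C2 * e1 + D * e1 * e2) * s1 * s2 + (B1 + C2 * e + C * e2 + D * e2 * e) * s2 * s
      + (B2 + C * e1 + C1 * e + D * e * e1) * s * s1
      + (A + B * e + B1 * e1 + B2 * e2 + C * e1 * e2 + C1 * e2 * e + C2 * e * e1 + D * e * e1 * e2) * s * s1 * s2"
  using assms by (simp add: field_simps)

text \<open>Here \<open>u\<close>, \<open>v\<close>, \<open>w\<close> will be the coordinate
  \<open>z\<close> and its powers \<open>z^q\<close>, \<open>z^(q^2)\<close>; the relation
  \<open>w * u = v\<close> removes \<open>w\<close> and leaves a quadratic in
  \<open>v\<close>.\<close>

lemma coords_identity:
  fixes u :: "'b::comm_ring_1"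
  assumes "w * u = v"
  shows "u * v * (c000 * (u * b0 * (v * b1) * (w * b2)) + c001 * (u * b0 * (v * b1) * b2)
      + c010 * (u * b0 * b1 * (w * b2)) + c011 * (u * b0 * b1 * b2) + c100 * (b0 * (v * b1) * (w * b2))
      + c101 * (b0 * (v * b1) * b2) + c110 * (b0 * b1 * (w * b2)) + c111 * (b0 * b1 * b2))
    = v * b0 * b1 * b2 * ((c010 + c101) * u * v + c001 * u\<^sup>2 * v + c000 * u * v\<^sup>2 + c100 * v\<^sup>2
      + c110 * v + c111 * u + c011 * u\<^sup>2)"
  unfolding assms[symmetric] by (simp add: algebra_simps power2_eq_square)

text \<open>The resultant of two quadratics vanishes at a common root. Eliminating
  \<open>v^2\<close> and eliminating the constant term give two relations linear in
  \<open>v\<close>.\<close>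

lemma common_root_resultant:
  fixes v :: "'b::idom"
  assumes "a * v\<^sup>2 + b * v + c = 0" and "a' * v\<^sup>2 + b' * v + c' = 0" and "v \<noteq> 0"
  shows "(a * c' - a' * c)\<^sup>2 = (a * b' - a' * b) * (b * c' - b' * c)"
proof -
  define P P' where "P = a * v\<^sup>2 + b * v + c" and "P' = a' * v\<^sup>2 + b' * v + c'"
  have "a * P' - a' * P = (a * b' - a' * b) * v + (a * c' - a' * c)"
    by (simp add: P_def P'_def algebra_simps)
  then have 1: "(a * b' - a' * b) * v = - (a * c' - a' * c)"
    using assms by (subst eq_neg_iff_add_eq_0) (simp add: P_def P'_def)
  have "P * c' - P' * c = v * ((a * c' - a' * c) * v + (b * c' - b' * c))"
    by (simp add: P_def P'_def algebra_simps power2_eq_square)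
  then have 2: "(a * c' - a' * c) * v = - (b * c' - b' * c)"
    using assms by (subst eq_neg_iff_add_eq_0) (simp add: P_def P'_def)
  have "(a * c' - a' * c)\<^sup>2 * v = ((a * b' - a' * b) * v) * - ((a * c' - a' * c) * v)"
    unfolding 1 by (simp add: power2_eq_square algebra_simps)
  also have "\<dots> = (a * b' - a' * b) * (b * c' - b' * c) * v"
    unfolding 2 by (simp add: mult_ac)
  finally show ?thesis
    using assms(3) by simp
qed

section \<open>The field of order \<open>q^3\<close>, its Frobenius map and its subfield\<close>

locale cubic_extension =
  fixes q :: nat and ty :: "'a::{finite,field} itself"
  assumes prime_power: "\<exists>p k. prime p \<and> k > 0 \<and> q = p ^ k"
    and card_UNIV: "card (UNIV :: 'a set) = q ^ 3"
    and q_ge_4: "q \<ge> 4"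
begin

text \<open>Adding 1 permutes the field, so \<open>q^3\<close> is zero in it; the characteristic is
  then the prime of which \<open>q\<close> is a power.\<close>

lemma q_char_power: obtains k where "prime CHAR('a)" "q = CHAR('a) ^ k"
proof -
  obtain p k where pk: "prime p" "q = p ^ k"
    using prime_power by auto
  have "prime CHAR('a)"
    by (rule prime_CHAR_semidom) (rule finite_imp_CHAR_pos, simp)
  moreover have "of_nat (q ^ 3) = (0 :: 'a)"
  proof -
    have "of_nat (card (UNIV :: 'a set)) = (0 :: 'a)"
    proof -
      have "(\<Sum>x\<in>UNIV. x + 1) = (\<Sum>x\<in>UNIV. x :: 'a)"
        by (rule sum.reindex_bij_witness[of _ "\<lambda>x. x - 1" "\<lambda>x. x + 1"]) auto
      then show ?thesis
        by (simp add: sum.distrib)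
    qed
    then show ?thesis
      by (simp add: card_UNIV)
  qed
  then have "CHAR('a) dvd p ^ (k * 3)"
    by (simp add: of_nat_eq_0_iff_char_dvd pk power_mult del: of_nat_power)
  ultimately have "CHAR('a) = p"
    using pk(1) by (metis prime_dvd_power primes_dvd_imp_eq)
  with pk \<open>prime CHAR('a)\<close> that show ?thesis
    by auto
qed

lemma frob_add_char:
  fixes x y :: "'b::comm_ring_1"
  assumes "CHAR('b) = CHAR('a)"
  shows "(x + y) ^ q = x ^ q + y ^ q"
proof -
  obtain k where k: "prime CHAR('a)" "q = CHAR('a) ^ k"
    by (rule q_char_power)
  show ?thesis
    by (rule freshmans_dream'[where n = k]) (use k assms in auto)
qed

lemma frob_add: "(x + y) ^ q = x ^ q + (y :: 'a) ^ q"
  and frob_add_ac: "(u + v) ^ q = u ^ q + (v :: 'a alg_closure) ^ q"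
  by (simp_all add: frob_add_char)

lemma frob_diff: "(x - y) ^ q = x ^ q - (y :: 'a) ^ q"
  using frob_add[of "x - y" y] by simp

lemma frob_diff_ac: "(x - y) ^ q = x ^ q - (y :: 'a alg_closure) ^ q"
  using frob_add_ac[of "x - y" y] by simp

lemma frob_0 [simp]: "(0 :: 'b::semiring_1) ^ q = 0" "(0 :: 'b) ^ (q\<^sup>2) = 0"
  using q_ge_4 by (auto simp: power_0_left)

lemma frob_uminus: "(- x) ^ q = - ((x :: 'a) ^ q)"
  using frob_diff[of 0 x] by simp

lemma frob2_eq: "x ^ (q\<^sup>2) = (x ^ q) ^ q"
  for x :: "'b::monoid_mult"
  by (simp add: power2_eq_square power_mult)

lemma frob2_add: "(x + y) ^ (q\<^sup>2) = x ^ (q\<^sup>2) + (y :: 'a) ^ (q\<^sup>2)"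
  and frob2_add_ac: "(u + v) ^ (q\<^sup>2) = u ^ (q\<^sup>2) + (v :: 'a alg_closure) ^ (q\<^sup>2)"
  by (simp_all add: frob2_eq frob_add frob_add_ac)

lemma frob2_diff: "(x - y) ^ (q\<^sup>2) = x ^ (q\<^sup>2) - (y :: 'a) ^ (q\<^sup>2)"
  and frob2_diff_ac: "(u - v) ^ (q\<^sup>2) = u ^ (q\<^sup>2) - (v :: 'a alg_closure) ^ (q\<^sup>2)"
  by (simp_all add: frob2_eq frob_diff frob_diff_ac)

text \<open>Multiplication by a nonzero \<open>x\<close> permutes the nonzero elements; comparing
  their products gives \<open>x^(q^3 - 1) = 1\<close>.\<close>

lemma power_q3: "(x :: 'a) ^ (q ^ 3) = x"
proof (cases "x = 0")
  case False
  have "(\<Prod>y\<in>UNIV - {0}. x * y) = (\<Prod>y\<in>UNIV - {0}. y)"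
    by (rule prod.reindex_bij_witness[of _ "\<lambda>y. y / x" "\<lambda>y. x * y"]) (use False in auto)
  then have "x ^ card (UNIV - {0 :: 'a}) = 1"
    by (simp add: prod.distrib)
  then have "x ^ (q ^ 3 - 1) = 1"
    by (simp add: card_Diff_subset card_UNIV)
  moreover have "q ^ 3 = Suc (q ^ 3 - 1)"
    using q_ge_4 by simp
  ultimately show ?thesis
    by (metis mult.right_neutral power_Suc)
qed (use q_ge_4 in simp)

lemma frob_frob:
  fixes x :: 'a
  shows "(x ^ q) ^ q = x ^ (q\<^sup>2)" "(x ^ (q\<^sup>2)) ^ q = x" "(x ^ q) ^ (q\<^sup>2) = x"
    "(x ^ (q\<^sup>2)) ^ (q\<^sup>2) = x ^ q"
proof -
  have "x ^ (q * q * q) = x"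
    using power_q3[of x] by (simp add: numeral_3_eq_3 mult.assoc)
  then show "(x ^ q) ^ q = x ^ (q\<^sup>2)" "(x ^ (q\<^sup>2)) ^ q = x" "(x ^ q) ^ (q\<^sup>2) = x"
    "(x ^ (q\<^sup>2)) ^ (q\<^sup>2) = x ^ q"
    by (simp_all add: power2_eq_square mult.assoc flip: power_mult)
      (simp add: power_mult mult.assoc flip: mult.assoc)
qed

abbreviation Fqa :: "'a set" where "Fqa \<equiv> Fq q"

lemma FqI: "x ^ q = x \<Longrightarrow> x \<in> Fqa"
  and FqD: "x \<in> Fqa \<Longrightarrow> x ^ q = x"
  by (simp_all add: Fq_def)

lemma FqD2: "x \<in> Fqa \<Longrightarrow> x ^ (q\<^sup>2) = x"
  by (simp add: frob2_eq FqD)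

lemma Fq_0 [simp]: "0 \<in> Fqa" and Fq_1 [simp]: "1 \<in> Fqa"
  by (simp_all add: Fq_def)

lemma Fq_add: "x \<in> Fqa \<Longrightarrow> y \<in> Fqa \<Longrightarrow> x + y \<in> Fqa"
  and Fq_diff: "x \<in> Fqa \<Longrightarrow> y \<in> Fqa \<Longrightarrow> x - y \<in> Fqa"
  and Fq_uminus: "x \<in> Fqa \<Longrightarrow> - x \<in> Fqa"
  and Fq_mult: "x \<in> Fqa \<Longrightarrow> y \<in> Fqa \<Longrightarrow> x * y \<in> Fqa"
  and Fq_divide: "x \<in> Fqa \<Longrightarrow> y \<in> Fqa \<Longrightarrow> x / y \<in> Fqa"
  by (simp_all add: Fq_def frob_add frob_diff frob_uminus power_mult_distrib power_divide)

lemma Fq_trace: "x + x ^ q + x ^ (q\<^sup>2) \<in> Fqa"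
  by (rule FqI) (simp add: frob_add frob_frob)

lemma Fq_norm: "x * x ^ q * x ^ (q\<^sup>2) \<in> Fqa"
  by (rule FqI) (simp add: power_mult_distrib frob_frob mult_ac)

lemma q_cube_factor: "q ^ 3 - 1 = (q\<^sup>2 + q + 1) * (q - 1)"
proof -
  obtain n where "q = Suc n"
    using q_ge_4 by (cases q) auto
  then show ?thesis
    by (simp add: power2_eq_square power3_eq_cube algebra_simps)
qed

lemma card_nonzero: "card (UNIV - {0 :: 'a}) = (q\<^sup>2 + q + 1) * (q - 1)"
  using q_cube_factor by (simp add: card_Diff_subset card_UNIV)

text \<open>The upper bound counts roots of \<open>x^q = x\<close>. For the lower bound, the norm
  sends the \<open>q^3 - 1\<close> nonzero elements into the nonzero part of \<open>Fqa\<close>,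
  with at most \<open>q^2 + q + 1\<close> elements in each fibre.\<close>

lemma card_Fq: "card Fqa = q"
proof (rule antisym)
  show "card Fqa \<le> q"
    unfolding Fq_def using q_ge_4 by (intro card_power_eq_self) auto
  have "card (UNIV - {0 :: 'a}) \<le> (q\<^sup>2 + q + 1) * card (Fqa - {0})"
  proof (rule card_le_fibres(2)[where f = "\<lambda>x. x ^ (q\<^sup>2 + q + 1)"])
    fix x :: 'a assume x: "x \<in> UNIV - {0}"
    have "x ^ (q\<^sup>2 + q + 1) = x * x ^ q * x ^ (q\<^sup>2)"
      by (simp add: power_add mult_ac)
    then show "x ^ (q\<^sup>2 + q + 1) \<in> Fqa - {0}"
      using x Fq_norm[of x] by (metis DiffE DiffI insertCI power_not_zero singletonD)
  next
    fix b :: 'a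
    have "card {a \<in> UNIV - {0}. a ^ (q\<^sup>2 + q + 1) = b} \<le> card {a. a ^ (q\<^sup>2 + q + 1) = b}"
      by (intro card_mono) auto
    then show "finite {a \<in> UNIV - {0}. a ^ (q\<^sup>2 + q + 1) = b} \<and>
        card {a \<in> UNIV - {0}. a ^ (q\<^sup>2 + q + 1) = b} \<le> q\<^sup>2 + q + 1"
      using card_power_eq(2)[of "q\<^sup>2 + q + 1" b] by auto
  qed simp
  then have "q - 1 \<le> card (Fqa - {0})"
    unfolding card_nonzero by (simp only: mult_le_cancel1)
  also have "card (Fqa - {0}) = card Fqa - 1"
    by simp
  finally show "q \<le> card Fqa"
    using q_ge_4 by linarith
qed

lemma to_ac_q3: "to_ac (x :: 'a) ^ (q ^ 3) = to_ac x"
  using power_q3[of x] by (metis to_ac_power)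

text \<open>The equation has at most \<open>q^3\<close> solutions in the closure, and the embedded
  field already supplies that many. Lying in the ground field thus becomes a fixed-point
  condition.\<close>

lemma range_to_ac: "range (to_ac :: 'a \<Rightarrow> _) = {x. x ^ (q ^ 3) = x}"
proof (rule card_subset_eq)
  have q3: "1 < q ^ 3"
    using q_ge_4 by (intro one_less_power) auto
  show "finite {x :: 'a alg_closure. x ^ (q ^ 3) = x}"
    using q3 by (rule card_power_eq_self)
  show "range (to_ac :: 'a \<Rightarrow> _) \<subseteq> {x. x ^ (q ^ 3) = x}"
    by (auto simp: to_ac_q3)
  have "card (range (to_ac :: 'a \<Rightarrow> _)) = q ^ 3"
    by (simp add: card_image inj_to_ac card_UNIV)
  then show "card (range (to_ac :: 'a \<Rightarrow> _)) = card {x :: 'a alg_closure. x ^ (q ^ 3) = x}"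
    using card_power_eq_self(2)[OF q3, where 'b = "'a alg_closure"]
      card_mono[OF \<open>finite {x :: 'a alg_closure. x ^ (q ^ 3) = x}\<close>
        \<open>range (to_ac :: 'a \<Rightarrow> _) \<subseteq> {x. x ^ (q ^ 3) = x}\<close>] by linarith
qed

lemma Fq_ac_cases:
  assumes "x ^ q = (x :: 'a alg_closure)"
  obtains l where "l \<in> Fqa" "x = to_ac l"
proof -
  have "x ^ (q ^ 3) = x"
    using assms by (simp add: numeral_3_eq_3 power_mult)
  then obtain l where l: "x = to_ac l"
    using range_to_ac by auto
  then have "to_ac (l ^ q) = to_ac l"
    using assms by simp
  then have "l \<in> Fqa"
    by (intro FqI) (simp only: to_ac_eq_iff)
  with l that show ?thesis by blast
qed

subsection \<open>Linear algebra over the subfield\<close>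

definition lin_closed :: "(nat \<Rightarrow> 'a) set \<Rightarrow> bool" where
  "lin_closed W \<longleftrightarrow> (\<lambda>_. 0) \<in> W \<and>
     (\<forall>u\<in>W. \<forall>v\<in>W. \<forall>c\<in>Fqa. (\<lambda>i. u i + c * v i) \<in> W)"

lemma lin_closedD:
  assumes "lin_closed W"
  shows "(\<lambda>_. 0) \<in> W" "\<lbrakk>u \<in> W; v \<in> W; c \<in> Fqa\<rbrakk> \<Longrightarrow> (\<lambda>i. u i + c * v i) \<in> W"
  using assms by (auto simp: lin_closed_def)

lemma lin_closed_scale: "lin_closed W \<Longrightarrow> v \<in> W \<Longrightarrow> c \<in> Fqa \<Longrightarrow> (\<lambda>i. c * v i) \<in> W"
  using lin_closedD(2)[of W "\<lambda>_. 0" v c] lin_closedD(1)[of W] by simp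

lemma lin_closed_diff: "lin_closed W \<Longrightarrow> u \<in> W \<Longrightarrow> v \<in> W \<Longrightarrow> (\<lambda>i. u i - v i) \<in> W"
  using lin_closedD(2)[of W u v "- 1"] by (simp add: Fq_uminus)

lemma fq_span_Nil: "fq_span q [] = {\<lambda>_. 0 :: 'a}"
  by (auto simp: fq_span_def intro: exI[of _ "\<lambda>_. 0"])

lemma fq_span_snoc:
  fixes vs :: "(nat \<Rightarrow> 'a) list"
  shows "fq_span q (vs @ [v]) = {(\<lambda>i. u i + c * v i) | u c. u \<in> fq_span q vs \<and> c \<in> Fqa}"
    (is "?L = ?R")
proof (intro Set.set_eqI iffI)
  fix w assume "w \<in> ?L"
  then obtain cs where cs: "\<forall>j. cs j \<in> Fqa"
    and w: "w = (\<lambda>i. \<Sum>j<Suc (length vs). cs j * ((vs @ [v]) ! j) i)"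
    by (auto simp: fq_span_def)
  define u where "u = (\<lambda>i. \<Sum>j<length vs. cs j * (vs ! j) i)"
  have "w = (\<lambda>i. u i + cs (length vs) * v i)"
    by (simp add: w u_def nth_append)
  moreover have "u \<in> fq_span q vs"
    using cs by (auto simp: fq_span_def u_def)
  ultimately show "w \<in> ?R"
    using cs by blast
next
  fix w assume "w \<in> ?R"
  then obtain cs c where cs: "\<forall>j. cs j \<in> Fqa" "c \<in> Fqa"
    and w: "w = (\<lambda>i. (\<Sum>j<length vs. cs j * (vs ! j) i) + c * v i)"
    by (auto simp: fq_span_def)
  have "w = (\<lambda>i. \<Sum>j<length (vs @ [v]). (cs(length vs := c)) j * ((vs @ [v]) ! j) i)"
    by (simp add: w nth_append)
  moreover have "\<forall>j. (cs(length vs := c)) j \<in> Fqa"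
    using cs by auto
  ultimately show "w \<in> ?L"
    unfolding fq_span_def by blast
qed

lemma fq_span_subset:
  assumes "lin_closed W" and "set vs \<subseteq> W"
  shows "fq_span q vs \<subseteq> W"
  using assms(2)
proof (induction vs rule: rev_induct)
  case Nil
  then show ?case using assms(1) by (simp add: fq_span_Nil lin_closedD)
next
  case (snoc v vs)
  then have "fq_span q vs \<subseteq> W" "v \<in> W"
    by auto
  then show ?case
    by (auto simp: fq_span_snoc intro!: lin_closedD(2)[OF assms(1)])
qed

lemma lin_closed_span: "lin_closed (fq_span q vs :: (nat \<Rightarrow> 'a) set)"
  unfolding lin_closed_def
proof (intro conjI ballI)
  show "(\<lambda>_. 0) \<in> (fq_span q vs :: (nat \<Rightarrow> 'a) set)"
    unfolding fq_span_def by (auto intro!: exI[of _ "\<lambda>_. 0"])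
next
  fix u v :: "nat \<Rightarrow> 'a" and c :: 'a
  assume "u \<in> fq_span q vs" "v \<in> fq_span q vs" and c: "c \<in> Fqa"
  then obtain cs ds where cs: "\<forall>j. cs j \<in> Fqa" "\<forall>j. ds j \<in> Fqa"
    and "u = (\<lambda>i. \<Sum>j<length vs. cs j * (vs ! j) i)" "v = (\<lambda>i. \<Sum>j<length vs. ds j * (vs ! j) i)"
    by (auto simp: fq_span_def)
  then have "(\<lambda>i. u i + c * v i) = (\<lambda>i. \<Sum>j<length vs. (cs j + c * ds j) * (vs ! j) i)"
    by (simp add: sum.distrib sum_distrib_left algebra_simps)
  moreover have "\<forall>j. cs j + c * ds j \<in> Fqa"
    using cs c by (auto intro: Fq_add Fq_mult)
  ultimately show "(\<lambda>i. u i + c * v i) \<in> fq_span q vs"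
    unfolding fq_span_def by (auto intro!: exI[of _ "\<lambda>j. cs j + c * ds j"])
qed

lemma fq_span_superset: "set vs \<subseteq> (fq_span q vs :: (nat \<Rightarrow> 'a) set)"
proof (induction vs rule: rev_induct)
  case (snoc v vs)
  have "u \<in> fq_span q (vs @ [v])" if "u \<in> fq_span q vs" for u
    using that unfolding fq_span_snoc by (auto intro!: exI[of _ u] exI[of _ 0])
  moreover have "v \<in> fq_span q (vs @ [v])"
    unfolding fq_span_snoc using lin_closedD(1)[OF lin_closed_span]
    by (auto intro!: exI[of _ "\<lambda>_. 0"] exI[of _ 1])
  ultimately show ?case
    using snoc by auto
qed simp

lemma fq_indepD:
  assumes "fq_indep q vs" and "\<forall>j. cs j \<in> Fqa"
    and "(\<lambda>i. \<Sum>j<length vs. cs j * (vs ! j) i) = (\<lambda>_. 0)" and "j < length vs"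
  shows "cs j = 0"
  using assms unfolding fq_indep_def by blast

lemma fq_indep_snoc:
  fixes vs :: "(nat \<Rightarrow> 'a) list"
  shows "fq_indep q (vs @ [v]) \<longleftrightarrow> fq_indep q vs \<and> v \<notin> fq_span q vs"
proof (intro iffI conjI)
  assume ind: "fq_indep q (vs @ [v])"
  show "fq_indep q vs"
    unfolding fq_indep_def
  proof (intro allI impI)
    fix cs :: "nat \<Rightarrow> 'a" and j
    assume cs: "\<forall>j. cs j \<in> Fqa" "(\<lambda>i. \<Sum>j<length vs. cs j * (vs ! j) i) = (\<lambda>_. 0)"
      and j: "j < length vs"
    have "(\<lambda>i. \<Sum>j<length (vs @ [v]). (cs(length vs := 0)) j * ((vs @ [v]) ! j) i) = (\<lambda>_. 0)"
      using cs(2) by (simp add: nth_append)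
    moreover have "\<forall>j. (cs(length vs := 0)) j \<in> Fqa"
      using cs by auto
    ultimately have "(cs(length vs := 0)) j = 0"
      using j by (intro fq_indepD[OF ind]) auto
    then show "cs j = 0"
      using j by simp
  qed
  show "v \<notin> fq_span q vs"
  proof
    assume "v \<in> fq_span q vs"
    then obtain cs where cs: "\<forall>j. cs j \<in> Fqa" "v = (\<lambda>i. \<Sum>j<length vs. cs j * (vs ! j) i)"
      by (auto simp: fq_span_def)
    have "(\<Sum>j<length vs. cs j * (vs ! j) i) = v i" for i
      using fun_cong[OF cs(2), of i] by simp
    then have "(\<lambda>i. \<Sum>j<length (vs @ [v]). (cs(length vs := - 1)) j * ((vs @ [v]) ! j) i) = (\<lambda>_. 0)"
      by (simp add: nth_append)
    moreover have "\<forall>j. (cs(length vs := - 1)) j \<in> Fqa"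
      using cs by (auto simp: Fq_uminus)
    ultimately have "(cs(length vs := - 1)) (length vs) = 0"
      by (intro fq_indepD[OF ind]) auto
    then show False by simp
  qed
next
  assume "fq_indep q vs \<and> v \<notin> fq_span q vs"
  then have ind: "fq_indep q vs" and v: "v \<notin> fq_span q vs"
    by auto
  show "fq_indep q (vs @ [v])"
    unfolding fq_indep_def
  proof (intro allI impI)
    fix cs :: "nat \<Rightarrow> 'a" and j
    assume cs: "\<forall>j. cs j \<in> Fqa"
      "(\<lambda>i. \<Sum>j<length (vs @ [v]). cs j * ((vs @ [v]) ! j) i) = (\<lambda>_. 0)"
      and j: "j < length (vs @ [v])"
    define u where "u = (\<lambda>i. \<Sum>j<length vs. cs j * (vs ! j) i)"
    have u: "u \<in> fq_span q vs"
      using cs(1) by (auto simp: fq_span_def u_def)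
    have eq: "u i + cs (length vs) * v i = 0" for i
      using fun_cong[OF cs(2), of i] by (simp add: nth_append u_def)
    have "cs (length vs) = 0"
    proof (rule ccontr)
      assume nz: "cs (length vs) \<noteq> 0"
      have "- 1 / cs (length vs) * u i = v i" for i
      proof -
        have "u i = - (cs (length vs) * v i)"
          using eq[of i] by (simp add: eq_neg_iff_add_eq_0)
        then show ?thesis using nz by simp
      qed
      moreover have "(\<lambda>i. - 1 / cs (length vs) * u i) \<in> fq_span q vs"
        using lin_closed_span u by (rule lin_closed_scale) (use cs(1) in \<open>auto intro!: Fq_divide Fq_uminus\<close>)
      ultimately show False
        using v by simp
    qed
    moreover have "cs j = 0" if "j < length vs" for j
    proof -
      have "u = (\<lambda>_. 0)"
        using eq \<open>cs (length vs) = 0\<close> by auto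
      then show ?thesis
        using ind that cs(1) unfolding fq_indep_def u_def by blast
    qed
    ultimately show "cs j = 0"
      using j by (auto simp: less_Suc_eq)
  qed
qed

text \<open>A vector \<open>v\<close> outside the span makes \<open>(u, c)\<close> recoverable from
  \<open>u + c v\<close>, so each step multiplies the size by \<open>q\<close>. Dimensions can then
  be compared through cardinalities.\<close>

lemma card_fq_span:
  fixes vs :: "(nat \<Rightarrow> 'a) list"
  assumes "fq_indep q vs"
  shows "finite (fq_span q vs)" and "card (fq_span q vs) = q ^ length vs"
proof -
  have "finite (fq_span q vs) \<and> card (fq_span q vs) = q ^ length vs"
    using assms
  proof (induction vs rule: rev_induct)
    case Nil
    then show ?case by (simp add: fq_span_Nil)
  next
    case (snoc v vs)
    then have v: "v \<notin> fq_span q vs" and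
      IH: "finite (fq_span q vs)" "card (fq_span q vs) = q ^ length vs"
      by (auto simp: fq_indep_snoc)
    define h where "h = (\<lambda>(u, c) (i::nat). u i + c * v i :: 'a)"
    have img: "fq_span q (vs @ [v]) = h ` (fq_span q vs \<times> Fqa)"
      unfolding fq_span_snoc h_def by force
    have "inj_on h (fq_span q vs \<times> Fqa)"
    proof (rule inj_onI, clarify)
      fix u u' :: "nat \<Rightarrow> 'a" and c c' :: 'a
      assume u: "u \<in> fq_span q vs" "u' \<in> fq_span q vs" "c \<in> Fqa" "c' \<in> Fqa"
        and "h (u, c) = h (u', c')"
      then have eq: "u i + c * v i = u' i + c' * v i" for i
        by (auto simp: h_def dest: fun_cong[of _ _ i])
      have "c = c'"
      proof (rule ccontr)
        assume "c \<noteq> c'"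
        have "(\<lambda>i. 1 / (c - c') * (u' i - u i)) \<in> fq_span q vs"
          using lin_closed_span lin_closed_diff[OF lin_closed_span u(2,1)]
          by (rule lin_closed_scale) (use u in \<open>auto intro!: Fq_divide Fq_diff\<close>)
        moreover have "1 / (c - c') * (u' i - u i) = v i" for i
        proof -
          have "u' i - u i = (c - c') * v i"
            using eq[of i] by (simp add: algebra_simps)
          then show ?thesis
            using \<open>c \<noteq> c'\<close> by simp
        qed
        ultimately show False
          using v by simp
      qed
      then show "u = u' \<and> c = c'"
        using eq by auto
    qed
    then have "card (fq_span q (vs @ [v])) = card (fq_span q vs) * card Fqa"
      unfolding img by (simp add: card_image card_cartesian_product)
    then show ?case
      using IH card_Fq by (simp add: img)
  qed
  then show "finite (fq_span q vs)" and "card (fq_span q vs) = q ^ length vs"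
    by auto
qed

lemma fq_basis_exists:
  fixes S :: "(nat \<Rightarrow> 'a) set"
  assumes "finite S"
  obtains vs where "set vs \<subseteq> S" "fq_indep q vs" "S \<subseteq> fq_span q vs"
proof -
  have "\<exists>vs. set vs \<subseteq> S \<and> fq_indep q vs \<and> S \<subseteq> fq_span q vs"
    using assms
  proof (induction S rule: finite_induct)
    case empty
    show ?case by (rule exI[of _ "[]"]) (simp add: fq_indep_def)
  next
    case (insert v S)
    then obtain vs where vs: "set vs \<subseteq> S" "fq_indep q vs" "S \<subseteq> fq_span q vs"
      by blast
    show ?case
    proof (cases "v \<in> fq_span q vs")
      case True
      then show ?thesis using vs by blast
    next
      case False
      have "S \<subseteq> fq_span q (vs @ [v])"
        using vs(3) fq_span_subset[OF lin_closed_span, of vs "vs @ [v]"]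
          fq_span_superset[of "vs @ [v]"] by auto
      then show ?thesis
        using vs False fq_span_superset[of "vs @ [v]"]
        by (intro exI[of _ "vs @ [v]"]) (auto simp: fq_indep_snoc)
    qed
  qed
  then show ?thesis using that by blast
qed

lemma fq_subspace_dimI:
  fixes W :: "(nat \<Rightarrow> 'a) set"
  assumes "lin_closed W" and "finite W" and "card W = q ^ k"
  shows "fq_subspace_dim q W k"
proof -
  obtain vs where vs: "set vs \<subseteq> W" "fq_indep q vs" "W \<subseteq> fq_span q vs"
    using assms(2) by (rule fq_basis_exists)
  have span: "fq_span q vs = W"
    using vs fq_span_subset[OF assms(1)] by blast
  then have "q ^ length vs = q ^ k"
    using card_fq_span(2)[OF vs(2)] assms(3) by simp
  then have "length vs = k"
    using q_ge_4 by (simp add: power_inject_exp)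
  then show ?thesis
    using vs span unfolding fq_subspace_dim_def by blast
qed

lemma fq_subspace_dimD:
  fixes W :: "(nat \<Rightarrow> 'a) set"
  assumes "fq_subspace_dim q W k"
  shows "lin_closed W" "finite W" "card W = q ^ k"
  using assms card_fq_span lin_closed_span unfolding fq_subspace_dim_def by auto

subsection \<open>Functionals and their values on the points of \<open>O1\<close>\<close>

text \<open>The tuple \<open>(A, B, C, D)\<close> stands for the functional
  \<open>A a + Tr (B b) + Tr (C c) + D d\<close> on \<open>U1\<close>.\<close>

definition dual :: "('a \<times> 'a \<times> 'a \<times> 'a) set" where
  "dual = Fqa \<times> UNIV \<times> UNIV \<times> Fqa"

definition lf :: "'a \<times> 'a \<times> 'a \<times> 'a \<Rightarrow> (nat \<Rightarrow> 'a) \<Rightarrow> 'a" where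
  "lf g v = (case g of (A, B, C, D) \<Rightarrow> A * v 0 + B ^ (q\<^sup>2) * v 1 + B ^ q * v 2 + C * v 3
     + B * v 4 + C ^ q * v 5 + C ^ (q\<^sup>2) * v 6 + D * v 7)"

lemma lf_linear: "lf g (\<lambda>i. u i + c * v i) = lf g u + c * lf g v"
  by (cases g) (simp add: lf_def algebra_simps)

lemma lf_diff_vec: "lf g (\<lambda>i. u i - v i) = lf g u - lf g v"
  by (cases g) (simp add: lf_def algebra_simps)

lemma lf_zero_vec: "lf g (\<lambda>i. 0) = 0"
  by (cases g) (simp add: lf_def)

lemma lf_diff: "lf (g - h) v = lf g v - lf h v"
  by (cases g, cases h) (simp add: lf_def frob_diff frob2_diff algebra_simps)

lemma lf_scale: "l \<in> Fqa \<Longrightarrow> lf (scale4 l g) v = l * lf g v"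
  by (cases g) (simp add: lf_def FqD FqD2 power_mult_distrib algebra_simps)

lemma dual_diff: "g \<in> dual \<Longrightarrow> h \<in> dual \<Longrightarrow> g - h \<in> dual"
  and dual_scale: "l \<in> Fqa \<Longrightarrow> g \<in> dual \<Longrightarrow> scale4 l g \<in> dual"
  by (auto simp: dual_def Fq_diff Fq_mult)

lemma card_dual: "card dual = q ^ 8"
proof -
  have "card dual = q * (q ^ 3 * (q ^ 3 * q))"
    unfolding dual_def by (simp only: card_cartesian_product card_Fq card_UNIV)
  also have "\<dots> = q ^ 8"
    by (simp add: eval_nat_numeral)
  finally show ?thesis .
qed

lemma lf_u1vec:
  "lf (A, B, C, D) (u1vec q a b c d) =
     A * a + (B * b + (B * b) ^ q + (B * b) ^ (q\<^sup>2)) + (C * c + (C * c) ^ q + (C * c) ^ (q\<^sup>2)) + D * d"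
  by (simp add: lf_def u1vec_def power_mult_distrib)

lemma lf_in_Fq: "g \<in> dual \<Longrightarrow> v \<in> U1 q \<Longrightarrow> lf g v \<in> Fqa"
  by (cases g) (auto simp: dual_def U1_def lf_u1vec intro!: Fq_add Fq_mult Fq_trace)

lemma lin_closed_U1: "lin_closed (U1 q)"
  unfolding lin_closed_def
proof (intro conjI ballI)
  show "(\<lambda>_. 0 :: 'a) \<in> U1 q"
  proof -
    have "(\<lambda>_. 0 :: 'a) = u1vec q 0 0 0 0"
      by (auto simp: u1vec_def)
    then show ?thesis
      unfolding U1_def using Fq_0 by blast
  qed
next
  fix u v :: "nat \<Rightarrow> 'a" and l :: 'a
  assume "u \<in> U1 q" "v \<in> U1 q" and l: "l \<in> Fqa"
  then obtain a b c d a' b' c' d' where uv: "u = u1vec q a b c d" "v = u1vec q a' b' c' d'"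
    "a \<in> Fqa" "d \<in> Fqa" "a' \<in> Fqa" "d' \<in> Fqa"
    unfolding U1_def by blast
  have "(\<lambda>i. u i + l * v i) = u1vec q (a + l * a') (b + l * b') (c + l * c') (d + l * d')"
    using l by (auto simp: uv u1vec_def frob_add frob2_add power_mult_distrib FqD FqD2)
  moreover have "a + l * a' \<in> Fqa" "d + l * d' \<in> Fqa"
    using l uv by (auto intro: Fq_add Fq_mult)
  ultimately show "(\<lambda>i. u i + l * v i) \<in> U1 q"
    unfolding U1_def by blast
qed

lemma finite_U1: "finite (U1 q :: (nat \<Rightarrow> 'a) set)"
  and card_U1: "card (U1 q :: (nat \<Rightarrow> 'a) set) \<le> q ^ 8"
proof -
  have U1: "U1 q = (\<lambda>(a, b, c, d). u1vec q a b c d) ` dual"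
    by (auto simp: U1_def dual_def image_def)
  show "finite (U1 q :: (nat \<Rightarrow> 'a) set)"
    unfolding U1 by simp
  show "card (U1 q :: (nat \<Rightarrow> 'a) set) \<le> q ^ 8"
    unfolding U1 using card_image_le[of dual] card_dual by auto
qed

section \<open>Annihilators, and evaluation at the points of \<open>O1\<close>\<close>

definition annih :: "(nat \<Rightarrow> 'a) set \<Rightarrow> ('a \<times> 'a \<times> 'a \<times> 'a) set" where
  "annih S = {g \<in> dual. \<forall>v\<in>S. lf g v = 0}"

text \<open>Each further vector imposes one condition with values in \<open>Fqa\<close>, which
  shrinks the annihilator by a factor of at most \<open>q\<close>.\<close>

lemma card_annih:
  assumes "set vs \<subseteq> U1 q"
  shows "q ^ 8 \<le> card (annih (set vs)) * q ^ length vs"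
  using assms
proof (induction vs)
  case Nil
  then show ?case by (simp add: annih_def card_dual)
next
  case (Cons v vs)
  have "card (annih (set vs)) \<le> card {g \<in> annih (set vs). lf g v = 0} * card Fqa"
  proof (rule card_le_kernel[where d = "(-)"])
    fix g assume "g \<in> annih (set vs)"
    then show "lf g v \<in> Fqa"
      using Cons.prems by (auto simp: annih_def intro: lf_in_Fq)
  qed (auto simp: annih_def lf_diff dual_diff inj_on_def)
  also have "{g \<in> annih (set vs). lf g v = 0} = annih (set (v # vs))"
    by (auto simp: annih_def)
  finally have "card (annih (set vs)) * q ^ length vs \<le> card (annih (set (v # vs))) * q ^ length (v # vs)"
    by (simp add: card_Fq)
  moreover have "q ^ 8 \<le> card (annih (set vs)) * q ^ length vs"
    using Cons by simp
  ultimately show ?case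
    by (rule order.trans[rotated])
qed

lemma annih_span: "annih (fq_span q vs) = annih (set vs)"
proof
  show "annih (fq_span q vs) \<subseteq> annih (set vs)"
    using fq_span_superset unfolding annih_def by blast
  have "fq_span q vs \<subseteq> {v. lf g v = 0}" if "g \<in> annih (set vs)" for g
    by (rule fq_span_subset) (use that in \<open>auto simp: lin_closed_def annih_def lf_linear lf_zero_vec\<close>)
  then show "annih (set vs) \<subseteq> annih (fq_span q vs)"
    unfolding annih_def by blast
qed

text \<open>The points are indexed by the projective line over the field of order
  \<open>q^3\<close>; \<open>None\<close> is its point at infinity.\<close>

fun ovec :: "'a option \<Rightarrow> nat \<Rightarrow> 'a" where
  "ovec None = u1vec q 0 0 0 1"
| "ovec (Some t) = u1vec q 1 t (t ^ (q\<^sup>2 + q)) (t ^ (q\<^sup>2 + q + 1))"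

definition ev :: "'a \<times> 'a \<times> 'a \<times> 'a \<Rightarrow> 'a option \<Rightarrow> 'a" where
  "ev g o' = lf g (ovec o')"

lemma t_power_q2_q: "(t :: 'a) ^ (q\<^sup>2 + q) = t ^ q * t ^ (q\<^sup>2)"
  "(t :: 'a) ^ (q\<^sup>2 + q + 1) = t * t ^ q * t ^ (q\<^sup>2)"
  by (simp_all add: power_add mult_ac)

lemma ev_None: "ev (A, B, C, D) None = D"
  by (simp add: ev_def lf_u1vec)

lemma ev_Some:
  "ev (A, B, C, D) (Some t) = A + B * t + B ^ q * t ^ q + B ^ (q\<^sup>2) * t ^ (q\<^sup>2) + C * t ^ q * t ^ (q\<^sup>2)
     + C ^ q * t ^ (q\<^sup>2) * t + C ^ (q\<^sup>2) * t * t ^ q + D * t * t ^ q * t ^ (q\<^sup>2)"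
  unfolding ev_def ovec.simps t_power_q2_q lf_u1vec
  by (simp add: power_mult_distrib frob_frob algebra_simps)

lemma ovec_in_U1: "ovec o' \<in> U1 q"
proof (cases o')
  case None
  then show ?thesis
    unfolding U1_def None ovec.simps using Fq_0 Fq_1 by blast
next
  case (Some t)
  have "t ^ (q\<^sup>2 + q + 1) \<in> Fqa"
    unfolding t_power_q2_q by (rule Fq_norm)
  then show ?thesis
    unfolding U1_def Some ovec.simps using Fq_1 by blast
qed

lemma ev_in_Fq: "g \<in> dual \<Longrightarrow> ev g o' \<in> Fqa"
  unfolding ev_def by (rule lf_in_Fq[OF _ ovec_in_U1])

lemma ev_diff: "ev (g - h) o' = ev g o' - ev h o'"
  and ev_scale: "l \<in> Fqa \<Longrightarrow> ev (scale4 l g) o' = l * ev g o'"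
  by (simp_all add: ev_def lf_diff lf_scale)

lemma fq_span_single: "fq_span q [v] = {(\<lambda>i. c * v i) | c. c \<in> Fqa}"
  using fq_span_snoc[of "[]" v] by (auto simp: fq_span_Nil)

definition opoint :: "'a option \<Rightarrow> (nat \<Rightarrow> 'a) set" where
  "opoint o' = fq_span q [ovec o']"

lemma O1_eq: "O1 q = range opoint"
proof -
  have "range opoint = insert (opoint None) (opoint ` range Some)"
    by (metis UNIV_option_conv image_insert)
  moreover have "opoint ` range Some = {Pt q 1 t (t ^ (q\<^sup>2 + q)) (t ^ (q\<^sup>2 + q + 1)) | t. True}"
    unfolding Pt_def opoint_def image_image ovec.simps by blast
  ultimately show ?thesis
    by (simp add: O1_def Pt_def opoint_def)
qed

lemma inj_opoint: "inj opoint"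
proof (rule injI)
  fix o1 o2 assume "opoint o1 = opoint o2"
  then have "ovec o1 \<in> opoint o2"
    using fq_span_superset[of "[ovec o1]"] by (auto simp: opoint_def)
  then obtain c where c: "ovec o1 = (\<lambda>i. c * ovec o2 i)"
    by (auto simp: opoint_def fq_span_single)
  show "o1 = o2"
    using fun_cong[OF c, of 0] fun_cong[OF c, of 4] fun_cong[OF c, of 7]
    by (cases o1; cases o2) (auto simp: u1vec_def)
qed

lemma opoint_subset_iff: "lin_closed W \<Longrightarrow> opoint o' \<subseteq> W \<longleftrightarrow> ovec o' \<in> W"
  using fq_span_subset[of W "[ovec o']"] fq_span_superset[of "[ovec o']"] by (auto simp: opoint_def)

lemma pts_in_O1: "lin_closed W \<Longrightarrow> pts_in (O1 q) W = opoint ` {o'. ovec o' \<in> W}"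
  using opoint_subset_iff[of W] by (auto simp only: pts_in_def O1_eq)

lemma card_pts_in_O1: "lin_closed W \<Longrightarrow> card (pts_in (O1 q) W) = card {o'. ovec o' \<in> W}"
  by (simp add: pts_in_O1 card_image inj_on_subset[OF inj_opoint])

text \<open>The polynomial in \<open>t\<close> has degree at most \<open>q^2 + q + 1 < q^3\<close>
  and \<open>q^3\<close> roots, so it is zero; none of the four coefficients in question shares its
  exponent with another term.\<close>

lemma functional_polynomial:
  fixes A B C D B1 B2 C1 C2 :: 'a
  assumes "\<And>t. A + B * t + B1 * t ^ q + B2 * t ^ (q\<^sup>2) + C * t ^ q * t ^ (q\<^sup>2)
     + C1 * t ^ (q\<^sup>2) * t + C2 * t * t ^ q + D * t * t ^ q * t ^ (q\<^sup>2) = 0"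
  shows "A = 0 \<and> B = 0 \<and> C = 0 \<and> D = 0"
proof -
  define p where "p = monom A 0 + monom B 1 + monom B1 q + monom B2 (q\<^sup>2) + monom C (q + q\<^sup>2)
     + monom C1 (q\<^sup>2 + 1) + monom C2 (q + 1) + monom D (q + q\<^sup>2 + 1)"
  have poly: "poly p t = 0" for t
    using assms[of t] by (simp add: p_def poly_monom power_add mult_ac)
  have le: "q + q\<^sup>2 + 1 < q ^ 3" "4 * q \<le> q\<^sup>2"
  proof -
    show q2: "4 * q \<le> q\<^sup>2"
      using q_ge_4 by (simp add: power2_eq_square)
    have "4 * q\<^sup>2 \<le> q ^ 3"
      using q_ge_4 by (simp add: power2_eq_square power3_eq_cube)
    with q2 q_ge_4 show "q + q\<^sup>2 + 1 < q ^ 3"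
      by linarith
  qed
  have "degree p \<le> q + q\<^sup>2 + 1"
    unfolding p_def using le q_ge_4
    by (intro degree_add_le order.trans[OF degree_monom_le]) auto
  have "p = 0"
  proof (rule ccontr)
    assume "p \<noteq> 0"
    then have "card {t. poly p t = 0} \<le> degree p"
      by (rule card_poly_roots_bound)
    then show False
      using \<open>degree p \<le> _\<close> le by (simp add: poly card_UNIV)
  qed
  then have co: "coeff p n = 0" for n
    by simp
  \<comment> \<open>Naming \<open>q^2\<close> makes the exponents linear, so that arithmetic tells
    them apart.\<close>
  define r where "r = q\<^sup>2"
  have r: "q + 1 < r" "1 < q" "q + r \<noteq> 0"
    using le q_ge_4 by (auto simp: r_def)
  note co = co[unfolded p_def r_def[symmetric]]
  show ?thesis
    using co[of 0] co[of 1] co[of "q + r"] co[of "q + r + 1"] r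
    by (simp add: coeff_monom)
qed

lemma ev_eq_0_imp:
  assumes "\<And>o'. ev g o' = 0"
  shows "g = 0"
proof -
  obtain A B C D where g: "g = (A, B, C, D)"
    by (cases g)
  show ?thesis
    using functional_polynomial[of A B "B ^ q" "B ^ (q\<^sup>2)" C "C ^ q" "C ^ (q\<^sup>2)" D]
      assms[of "Some _"] unfolding g ev_Some by (simp add: zero_prod_def)
qed

text \<open>At most \<open>q\<close> fibres, none larger than the kernel, give one inequality; the
  distinct translates of the kernel by multiples of \<open>v\<close> give the other.\<close>

lemma card_kernel:
  assumes "lin_closed W" and "W \<subseteq> U1 q" and "g \<in> dual" and "v \<in> W" and "lf g v \<noteq> 0"
  shows "card W = card {u \<in> W. lf g u = 0} * q"
proof (rule antisym)
  have fin: "finite W"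
    using assms(2) finite_U1 finite_subset by blast
  have "card W \<le> card {u \<in> W. lf g u = 0} * card Fqa"
  proof (rule card_le_kernel[where d = "\<lambda>u v i. u i - v i"])
    show "lf g u \<in> Fqa" if "u \<in> W" for u
      using that assms by (auto intro: lf_in_Fq)
    show "inj_on (\<lambda>a i. a i - b i) W" for b :: "nat \<Rightarrow> 'a"
      by (rule inj_onI) (auto simp: fun_eq_iff)
  qed (use fin assms(1) in \<open>auto simp: lf_diff_vec lin_closed_diff\<close>)
  then show "card W \<le> card {u \<in> W. lf g u = 0} * q"
    by (simp add: card_Fq)
  have "card ({u \<in> W. lf g u = 0} \<times> Fqa) \<le> card W"
  proof (rule card_inj_on_le[where f = "\<lambda>(u, c) i. u i + c * v i"])
    show "inj_on (\<lambda>(u, c) i. u i + c * v i) ({u \<in> W. lf g u = 0} \<times> Fqa)"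
    proof (rule inj_onI, clarify)
      fix u u' :: "nat \<Rightarrow> 'a" and c c' :: 'a
      assume u: "lf g u = 0" "lf g u' = 0" and eq: "(\<lambda>i. u i + c * v i) = (\<lambda>i. u' i + c' * v i)"
      have "lf g (\<lambda>i. u i + c * v i) = lf g (\<lambda>i. u' i + c' * v i)"
        by (simp only: eq)
      then have "c = c'"
        using u assms(5) by (simp add: lf_linear)
      with fun_cong[OF eq] show "u = u' \<and> c = c'"
        by auto
    qed
  qed (use fin assms lin_closedD(2)[OF assms(1)] in auto)
  then show "card {u \<in> W. lf g u = 0} * q \<le> card W"
    by (simp add: card_cartesian_product card_Fq)
qed

lemma lin_closed_kernel: "lin_closed W \<Longrightarrow> lin_closed {u \<in> W. lf g u = 0}"
  by (auto simp: lin_closed_def lf_linear lf_zero_vec)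

text \<open>Seven vectors leave at least \<open>q\<close> functionals in the annihilator, hence a
  nonzero \<open>F\<close>. Its kernel contains \<open>H\<close>, and since \<open>F\<close> is
  nonzero at some point of \<open>O1\<close> the kernel has at most \<open>q^7\<close>
  elements.\<close>

lemma hyperplane_is_kernel:
  assumes "H \<subseteq> U1 q" and "fq_subspace_dim q H 7"
  obtains F where "F \<in> dual" "F \<noteq> 0" "H = {u \<in> U1 q. lf F u = 0}"
proof -
  note H = fq_subspace_dimD[OF assms(2)]
  obtain vs where vs: "length vs = 7" "set vs \<subseteq> H" "fq_span q vs = H"
    using assms(2) unfolding fq_subspace_dim_def by blast
  have "q ^ 8 \<le> card (annih H) * q ^ 7"
    using card_annih[of vs] vs assms(1) annih_span[of vs] by auto
  then have "q ^ 7 * q \<le> q ^ 7 * card (annih H)"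
    by (simp add: mult.commute flip: power_Suc)
  then have "q \<le> card (annih H)"
    using q_ge_4 by simp
  then have "\<not> annih H \<subseteq> {0}"
    using q_ge_4 card_mono[of "{0}" "annih H"] by fastforce
  then obtain F where F: "F \<in> dual" "\<forall>v\<in>H. lf F v = 0" "F \<noteq> 0"
    by (auto simp: annih_def)
  obtain o1 where "ev F o1 \<noteq> 0"
    using ev_eq_0_imp F(3) by blast
  then have "card {u \<in> U1 q. lf F u = 0} * q = card (U1 q :: (nat \<Rightarrow> 'a) set)"
    using card_kernel[OF lin_closed_U1 _ F(1) ovec_in_U1] by (simp add: ev_def)
  also have "\<dots> \<le> q ^ 7 * q"
    using card_U1 by (simp add: eval_nat_numeral mult_ac)
  finally have "card {u \<in> U1 q. lf F u = 0} \<le> card H"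
    using q_ge_4 H(3) by simp
  then have "H = {u \<in> U1 q. lf F u = 0}"
    using F(2) assms(1) finite_U1 by (intro card_seteq) auto
  with F that show ?thesis by blast
qed

subsection \<open>Functionals whose Hessian has a root over the ground field\<close>

definition zeros :: "'a \<times> 'a \<times> 'a \<times> 'a \<Rightarrow> 'a option set" where
  "zeros g = {o'. ev g o' = 0}"

text \<open>The determinant of the bilinear form in \<open>(s\<^sub>1, s\<^sub>2)\<close> which arises from the
  trilinear form \<open>T(s\<^sub>0, s\<^sub>1, s\<^sub>2)\<close> with \<open>ev g (Some t) = T(t, t\<^sup>q, t\<^bsup>q\<^sup>2\<^esup>)\<close> when
  \<open>s\<^sub>0 = t\<close> is fixed.\<close>

definition hessian :: "'a \<times> 'a \<times> 'a \<times> 'a \<Rightarrow> 'a \<Rightarrow> 'a" where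
  "hessian g t = (case g of (A, B, C, D) \<Rightarrow>
     (A + B * t) * (C + D * t) - (B ^ q + C ^ (q\<^sup>2) * t) * (B ^ (q\<^sup>2) + C ^ q * t))"

text \<open>The quotients \<open>y^q / y = y^(q-1)\<close> have norm 1, and each arises from at most
  \<open>q - 1\<close> elements \<open>y\<close>.\<close>

lemma card_norm_one: "q\<^sup>2 + q + 1 \<le> card ((\<lambda>y :: 'a. y ^ q / y) ` (UNIV - {0}))"
proof -
  have "card (UNIV - {0 :: 'a}) \<le> (q - 1) * card ((\<lambda>y :: 'a. y ^ q / y) ` (UNIV - {0}))"
  proof (rule card_le_fibres(2)[where f = "\<lambda>y. y ^ q / y"])
    fix b :: 'a
    have "y ^ q / y = y ^ (q - 1)" if "y \<noteq> 0" for y :: 'a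
      using that q_ge_4 by (cases q) auto
    then have "card {a \<in> UNIV - {0}. a ^ q / a = b} \<le> card {a. a ^ (q - 1) = b}"
      by (intro card_mono) auto
    also have "\<dots> \<le> q - 1"
      using q_ge_4 by (intro card_power_eq) auto
    finally show "finite {a \<in> UNIV - {0}. a ^ q / a = b} \<and> card {a \<in> UNIV - {0}. a ^ q / a = b} \<le> q - 1"
      by simp
  qed auto
  then have "(q - 1) * (q\<^sup>2 + q + 1) \<le> (q - 1) * card ((\<lambda>y :: 'a. y ^ q / y) ` (UNIV - {0}))"
    unfolding card_nonzero by (simp only: mult.commute)
  then show ?thesis
    using q_ge_4 by (simp only: mult_le_cancel1)
qed

text \<open>The differences \<open>y^q - y\<close> have trace 0; they are the image of an additive
  map with kernel \<open>Fqa\<close>.\<close>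

lemma card_trace_zero: "q\<^sup>2 \<le> card (range (\<lambda>y :: 'a. y ^ q - y))"
proof -
  have "card (UNIV :: 'a set) \<le> card {a \<in> UNIV. a ^ q - a = (0 :: 'a)} * card (range (\<lambda>y :: 'a. y ^ q - y))"
    by (rule card_le_kernel[where d = "(-)"]) (auto simp: frob_diff inj_on_def algebra_simps)
  also have "{a \<in> UNIV. a ^ q - a = (0 :: 'a)} = Fqa"
    by (auto simp: Fq_def)
  finally have "q * q\<^sup>2 \<le> q * card (range (\<lambda>y :: 'a. y ^ q - y))"
    by (simp add: card_UNIV card_Fq power2_eq_square power3_eq_cube)
  then show ?thesis
    using q_ge_4 by simp
qed

lemma q_size: "13 \<le> q\<^sup>2 - q + 1" "q\<^sup>2 - q + 1 \<le> q\<^sup>2" "q\<^sup>2 - q + 1 < q ^ 3"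
proof -
  have "4 * q \<le> q\<^sup>2" "4 * q\<^sup>2 \<le> q ^ 3"
    using q_ge_4 by (simp_all add: power2_eq_square power3_eq_cube)
  then show "13 \<le> q\<^sup>2 - q + 1" "q\<^sup>2 - q + 1 \<le> q\<^sup>2" "q\<^sup>2 - q + 1 < q ^ 3"
    using q_ge_4 by linarith+
qed

text \<open>The condition on \<open>B * D\<close> puts a root of the Hessian at infinity. Completing
  the cube gives the norm equation \<open>N (D t + C) = n\<close>, with at most one solution for
  \<open>n = 0\<close> and otherwise none or at least \<open>q^2 + q + 1\<close>.\<close>

lemma card_zeros_parabolic_norm:
  assumes "A \<in> Fqa" and D: "D \<in> Fqa" "D \<noteq> 0" and BD: "B * D = C ^ q * C ^ (q\<^sup>2)"
  shows "card (zeros (A, B, C, D)) \<noteq> q\<^sup>2 - q + 1"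
proof
  let ?X = "zeros (A, B, C, D)"
  assume card: "card ?X = q\<^sup>2 - q + 1"
  define n where "n = C * C ^ q * C ^ (q\<^sup>2) - A * D\<^sup>2"
  define N :: "'a \<Rightarrow> 'a" where "N y = y * y ^ q * y ^ (q\<^sup>2)" for y
  have N_mult: "N (x * y) = N x * N y" for x y
    by (simp add: N_def power_mult_distrib mult_ac)
  have BD1: "B ^ q * D = C ^ (q\<^sup>2) * C" "B ^ (q\<^sup>2) * D = C * C ^ q"
    using arg_cong[OF BD, of "\<lambda>x. x ^ q"] arg_cong[OF BD, of "\<lambda>x. x ^ (q\<^sup>2)"] D
    by (simp_all add: power_mult_distrib frob_frob FqD FqD2)
  have evN: "D\<^sup>2 * ev (A, B, C, D) (Some t) = N (D * t + C) - n" for t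
  proof -
    have "N (D * t + C) = (D * t + C) * (D * t ^ q + C ^ q) * (D * t ^ (q\<^sup>2) + C ^ (q\<^sup>2))"
      using D by (simp add: N_def frob_add frob2_add power_mult_distrib FqD FqD2)
    also have "\<dots> = D ^ 3 * t * t ^ q * t ^ (q\<^sup>2)
        + D\<^sup>2 * (C * t ^ q * t ^ (q\<^sup>2) + C ^ q * t ^ (q\<^sup>2) * t + C ^ (q\<^sup>2) * t * t ^ q)
        + D * ((C ^ q * C ^ (q\<^sup>2)) * t + (C ^ (q\<^sup>2) * C) * t ^ q + (C * C ^ q) * t ^ (q\<^sup>2)) + C * C ^ q * C ^ (q\<^sup>2)"
      by (simp add: algebra_simps power2_eq_square power3_eq_cube)
    also have "\<dots> = D\<^sup>2 * ev (A, B, C, D) (Some t) + n"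
      unfolding BD[symmetric] BD1[symmetric] ev_Some n_def
      by (simp add: algebra_simps power2_eq_square power3_eq_cube)
    finally show ?thesis by simp
  qed
  have zero_iff: "Some t \<in> ?X \<longleftrightarrow> N (D * t + C) = n" for t
    using evN[of t] D by (auto simp: zeros_def)
  have None: "None \<notin> ?X"
    using D by (simp add: zeros_def ev_None)
  show False
  proof (cases "n = 0")
    case True
    have "?X \<subseteq> {Some (- C / D)}"
    proof
      fix o' assume o': "o' \<in> ?X"
      then obtain t where t: "o' = Some t"
        using None by (cases o') auto
      then have "D * t + C = 0"
        using o' zero_iff[of t] True by (auto simp: N_def)
      then have "D * t = - C"
        by (simp add: eq_neg_iff_add_eq_0)
      then have "t = - C / D"
        using D(2) by (metis nonzero_mult_div_cancel_left)
      then show "o' \<in> {Some (- C / D)}"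
        by (simp add: t)
    qed
    then have "card ?X \<le> 1"
      using card_mono[of "{Some (- C / D)}" ?X] by simp
    then show False
      using card q_size by linarith
  next
    case False
    have "?X \<noteq> {}"
      using card q_size by auto
    then obtain t0 where t0: "N (D * t0 + C) = n"
      using None zero_iff by (metis all_not_in_conv option.exhaust)
    have nz: "D * t0 + C \<noteq> 0"
      using t0 False by (auto simp: N_def)
    \<comment> \<open>A solution times an element of norm 1 is again a solution; \<open>h\<close>
      undoes the substitution \<open>D t + C\<close>.\<close>
    define h where "h k = Some (((D * t0 + C) * k - C) / D)" for k
    have "card ((\<lambda>y :: 'a. y ^ q / y) ` (UNIV - {0})) \<le> card ?X"
    proof (rule card_inj_on_le[where f = h])
      show "inj_on h ((\<lambda>y :: 'a. y ^ q / y) ` (UNIV - {0}))"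
        using nz D by (auto simp: inj_on_def h_def)
      show "h ` (\<lambda>y :: 'a. y ^ q / y) ` (UNIV - {0}) \<subseteq> ?X"
        unfolding image_image
      proof (rule image_subsetI)
        fix y :: 'a assume "y \<in> UNIV - {0}"
        then have y: "y \<noteq> 0" by simp
        have "N (y ^ q / y) = 1"
          using y by (simp add: N_def power_divide frob_frob)
        then have "N ((D * t0 + C) * (y ^ q / y)) = n"
          using t0 by (simp only: N_mult mult_1_right)
        then show "h (y ^ q / y) \<in> ?X"
          using D(2) by (simp add: h_def zero_iff)
      qed
    qed auto
    then show False
      using card card_norm_one q_size by linarith
  qed
qed

text \<open>The functional is \<open>A + Tr(B t)\<close>, and infinity is always a zero. For
  \<open>B \<noteq> 0\<close> a finite zero can be shifted by \<open>k / B\<close> with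
  \<open>k\<close> of trace 0, which gives more than \<open>q^2\<close> zeros; for
  \<open>B = 0\<close> one finite zero makes every point a zero.\<close>

lemma card_zeros_parabolic_trace: "card (zeros (A, B, 0, 0)) \<noteq> q\<^sup>2 - q + 1"
proof
  let ?X = "zeros (A, B, 0, 0)"
  assume card: "card ?X = q\<^sup>2 - q + 1"
  have ev: "ev (A, B, 0, 0) (Some t) = A + (B * t + (B * t) ^ q + (B * t) ^ (q\<^sup>2))" for t
    by (simp add: ev_Some power_mult_distrib)
  have None: "None \<in> ?X"
    by (simp add: zeros_def ev_None)
  have "\<not> ?X \<subseteq> {None}"
    using card_mono[of "{None}" ?X] card q_size by auto
  then obtain t0 where t0: "Some t0 \<in> ?X"
    by (metis insertI1 option.exhaust subsetI)
  show False
  proof (cases "B = 0")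
    case True
    then have "o' \<in> ?X" for o'
      using t0 None ev by (cases o') (auto simp: zeros_def)
    then have "?X = UNIV"
      by blast
    then have "card (range (Some :: 'a \<Rightarrow> _)) \<le> card ?X"
      by (intro card_mono) auto
    then show False
      using card q_size by (simp add: card_image card_UNIV)
  next
    case False
    define h where "h k = Some (t0 + k / B)" for k
    have "card (range (\<lambda>y :: 'a. y ^ q - y)) \<le> card (?X - {None})"
    proof (rule card_inj_on_le[where f = h])
      show "inj_on h (range (\<lambda>y :: 'a. y ^ q - y))"
        using False by (auto simp: inj_on_def h_def)
      show "h ` range (\<lambda>y :: 'a. y ^ q - y) \<subseteq> ?X - {None}"
      proof clarify
        fix y :: 'a
        have "B * (t0 + (y ^ q - y) / B) = B * t0 + (y ^ q - y)"
          using False by (simp add: field_simps)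
        then have "ev (A, B, 0, 0) (Some (t0 + (y ^ q - y) / B)) = ev (A, B, 0, 0) (Some t0)"
          unfolding ev by (simp add: frob_add frob2_add frob_diff frob2_diff frob_frob)
        then show "h (y ^ q - y) \<in> ?X - {None}"
          using t0 by (simp add: h_def zeros_def)
      qed
    qed auto
    also have "card (?X - {None}) = card ?X - 1"
      using None by simp
    finally show False
      using card card_trace_zero q_size by linarith
  qed
qed

lemma card_zeros_hessian_infinity:
  assumes "(A, B, C, D) \<in> dual" and "B * D = C ^ q * C ^ (q\<^sup>2)"
  shows "card (zeros (A, B, C, D)) \<noteq> q\<^sup>2 - q + 1"
proof (cases "D = 0")
  case True
  then have "C = 0"
    using assms(2) by auto
  then show ?thesis
    using True card_zeros_parabolic_trace by simp
next
  case False
  then show ?thesis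
    using assms card_zeros_parabolic_norm by (auto simp: dual_def)
qed

text \<open>The bijection \<open>t = e + 1/s\<close> of the projective line keeps the number of
  zeros and moves the root \<open>e\<close> to infinity, the case already settled.\<close>

lemma card_zeros_hessian_root:
  assumes g: "(A, B, C, D) \<in> dual" and root: "hessian (A, B, C, D) e = 0"
  shows "card (zeros (A, B, C, D)) \<noteq> q\<^sup>2 - q + 1"
proof -
  \<comment> \<open>These are the coefficients on the right of
    \<open>inversion_identity\<close>.\<close>
  define B' where "B' = C + D * e"
  define C' where "C' = B + C ^ q * e ^ (q\<^sup>2) + C ^ (q\<^sup>2) * e ^ q + D * e ^ q * e ^ (q\<^sup>2)"
  define D' where "D' = ev (A, B, C, D) (Some e)"
  define g' where "g' = (D, B', C', D')"
  have D: "D ^ q = D" "D ^ (q\<^sup>2) = D"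
    using g by (auto simp: dual_def FqD FqD2)
  have conj: "B' ^ q = C ^ q + D * e ^ q" "B' ^ (q\<^sup>2) = C ^ (q\<^sup>2) + D * e ^ (q\<^sup>2)"
    "C' ^ q = B ^ q + C ^ (q\<^sup>2) * e + C * e ^ (q\<^sup>2) + D * e ^ (q\<^sup>2) * e"
    "C' ^ (q\<^sup>2) = B ^ (q\<^sup>2) + C * e ^ q + C ^ q * e + D * e * e ^ q"
    by (simp_all add: B'_def C'_def frob_add frob2_add power_mult_distrib D frob_frob)
  have g': "g' \<in> dual"
    using g ev_in_Fq[OF g] by (auto simp: g'_def D'_def dual_def)
  have "B' * D' = C' ^ q * C' ^ (q\<^sup>2)"
    using root hessian_shift_identity[of C D e A B "B ^ q" "e ^ q" "B ^ (q\<^sup>2)" "e ^ (q\<^sup>2)" "C ^ q" "C ^ (q\<^sup>2)"]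
    unfolding conj ev_Some D'_def B'_def hessian_def by simp
  then have "card (zeros g') \<noteq> q\<^sup>2 - q + 1"
    using card_zeros_hessian_infinity g' unfolding g'_def by blast
  moreover have "card (zeros g') = card (zeros (A, B, C, D))"
  proof (rule bij_betw_same_card, rule bij_betwI')
    \<comment> \<open>The map \<open>s |-> e + 1/s\<close>, completed by sending infinity to
      \<open>e\<close> and 0 to infinity.\<close>
    define h where "h o' = (case o' of None \<Rightarrow> Some e | Some s \<Rightarrow> if s = 0 then None else Some (e + 1 / s))" for o'
    have ev_h: "ev g' o' = 0 \<longleftrightarrow> ev (A, B, C, D) (h o') = 0" for o'
    proof (cases o')
      case None
      then show ?thesis by (simp add: g'_def ev_None h_def D'_def)
    next
      case (Some s)
      show ?thesis
      proof (cases "s = 0")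
        case True
        then show ?thesis
          by (simp add: Some h_def ev_None g'_def ev_Some)
      next
        case False
        have "s * s ^ q * s ^ (q\<^sup>2) * ev (A, B, C, D) (Some (e + 1 / s)) = ev g' (Some s)"
          unfolding ev_Some g'_def conj
          unfolding D'_def C'_def B'_def ev_Some
          using inversion_identity[of s "s ^ q" "s ^ (q\<^sup>2)" A B e "B ^ q" "e ^ q" "B ^ (q\<^sup>2)" "e ^ (q\<^sup>2)" C "C ^ q" "C ^ (q\<^sup>2)" D] False
          by (simp only: frob_add frob2_add power_divide power_one power_not_zero not_False_eq_True)
        then show ?thesis
          using False by (simp add: Some h_def) (metis mult_eq_0_iff power_not_zero)
      qed
    qed
    show "h o' \<in> zeros (A, B, C, D)" if "o' \<in> zeros g'" for o'
      using that ev_h by (simp add: zeros_def)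
    show "(h x = h y) = (x = y)" for x y
      by (cases x; cases y) (auto simp: h_def)
    show "\<exists>x\<in>zeros g'. y = h x" if "y \<in> zeros (A, B, C, D)" for y
    proof -
      define x where "x = (case y of None \<Rightarrow> Some 0 | Some t \<Rightarrow> if t = e then None else Some (1 / (t - e)))"
      have "h x = y"
        by (cases y) (auto simp: x_def h_def)
      then show ?thesis
        using that ev_h by (auto simp: zeros_def)
    qed
  qed
  ultimately show ?thesis by simp
qed

subsection \<open>The trilinear form over the algebraic closure\<close>

text \<open>Homogeneous version: each slot holds a vector \<open>(x, y)\<close> over the closure
  standing for the parameter \<open>x / y\<close>, and three independent slots replace
  \<open>t\<close>, \<open>t^q\<close>, \<open>t^(q^2)\<close>.\<close>

definition tri :: "'a \<times> 'a \<times> 'a \<times> 'a \<Rightarrow> 'a alg_closure \<Rightarrow> 'a alg_closure \<Rightarrow> 'a alg_closure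
    \<Rightarrow> 'a alg_closure \<Rightarrow> 'a alg_closure \<Rightarrow> 'a alg_closure \<Rightarrow> 'a alg_closure" where
  "tri g x0 y0 x1 y1 x2 y2 = (case g of (A, B, C, D) \<Rightarrow>
     to_ac A * y0 * y1 * y2 + to_ac B * x0 * y1 * y2 + to_ac B ^ q * y0 * x1 * y2
     + to_ac B ^ (q\<^sup>2) * y0 * y1 * x2 + to_ac C * y0 * x1 * x2 + to_ac C ^ q * x0 * y1 * x2
     + to_ac C ^ (q\<^sup>2) * x0 * x1 * y2 + to_ac D * x0 * x1 * x2)"

lemma tri_linear:
  "tri g (a * x + b * x') (a * y + b * y') x1 y1 x2 y2 = a * tri g x y x1 y1 x2 y2 + b * tri g x' y' x1 y1 x2 y2"
  "tri g x0 y0 (a * x + b * x') (a * y + b * y') x2 y2 = a * tri g x0 y0 x y x2 y2 + b * tri g x0 y0 x' y' x2 y2"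
  "tri g x0 y0 x1 y1 (a * x + b * x') (a * y + b * y') = a * tri g x0 y0 x1 y1 x y + b * tri g x0 y0 x1 y1 x' y'"
  by (cases g; simp add: tri_def algebra_simps)+

lemma tri_homogeneous:
  "tri g (a * x) (a * y) (b * x1) (b * y1) (c * x2) (c * y2) = a * b * c * tri g x y x1 y1 x2 y2"
  by (cases g; simp add: tri_def algebra_simps)

lemma tri_diff: "tri (g - h) x0 y0 x1 y1 x2 y2 = tri g x0 y0 x1 y1 x2 y2 - tri h x0 y0 x1 y1 x2 y2"
  by (cases g; cases h; simp add: tri_def frob_diff_ac frob2_diff_ac algebra_simps)

lemma to_ac_Fq: "l \<in> Fqa \<Longrightarrow> to_ac l ^ q = to_ac l" "l \<in> Fqa \<Longrightarrow> to_ac l ^ (q\<^sup>2) = to_ac l"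
  by (simp_all add: FqD FqD2 flip: to_ac_power)

lemma tri_scale: "l \<in> Fqa \<Longrightarrow> tri (scale4 l g) x0 y0 x1 y1 x2 y2 = to_ac l * tri g x0 y0 x1 y1 x2 y2"
  by (cases g; simp add: tri_def power_mult_distrib to_ac_Fq algebra_simps)

lemma frob_frob_to_ac:
  "(to_ac (x :: 'a) ^ q) ^ q = to_ac x ^ (q\<^sup>2)" "(to_ac (x :: 'a) ^ (q\<^sup>2)) ^ q = to_ac x"
  "(to_ac (x :: 'a) ^ (q\<^sup>2)) ^ (q\<^sup>2) = to_ac x ^ q"
  by (simp_all add: frob_frob flip: to_ac_power)

text \<open>Frobenius permutes the conjugates of \<open>B\<close> and of \<open>C\<close> cyclically
  and fixes \<open>A\<close> and \<open>D\<close>, which amounts to rotating the three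
  slots.\<close>

lemma tri_frob:
  assumes "g \<in> dual"
  shows "tri g x0 y0 x1 y1 x2 y2 ^ q = tri g (x2 ^ q) (y2 ^ q) (x0 ^ q) (y0 ^ q) (x1 ^ q) (y1 ^ q)"
  using assms by (cases g)
    (simp add: tri_def dual_def frob_add_ac power_mult_distrib to_ac_Fq frob_frob_to_ac algebra_simps)

text \<open>Together with \<open>oy\<close> these are homogeneous coordinates on the projective
  line, with \<open>(1, 0)\<close> at infinity.\<close>

definition ox :: "'a option \<Rightarrow> 'a alg_closure" where
  "ox o' = (case o' of None \<Rightarrow> 1 | Some t \<Rightarrow> to_ac t)"

definition oy :: "'a option \<Rightarrow> 'a alg_closure" where
  "oy o' = (case o' of None \<Rightarrow> 0 | Some t \<Rightarrow> 1)"

lemma tri_ev: "to_ac (ev g o') = tri g (ox o') (oy o') (ox o' ^ q) (oy o' ^ q) (ox o' ^ (q\<^sup>2)) (oy o' ^ (q\<^sup>2))"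
proof -
  obtain A B C D where g: "g = (A, B, C, D)"
    by (cases g)
  show ?thesis
    unfolding g
    by (cases o') (simp_all add: ev_None ev_Some tri_def ox_def oy_def)
qed

lemma frob3_eq: "x ^ (q ^ 3) = ((x ^ q) ^ q) ^ q"
  for x :: "'b::monoid_mult"
  by (simp add: numeral_3_eq_3 power_mult)

lemma frob3_add_ac: "(x + y) ^ (q ^ 3) = x ^ (q ^ 3) + (y :: 'a alg_closure) ^ (q ^ 3)"
  and frob3_diff_ac: "(x - y) ^ (q ^ 3) = x ^ (q ^ 3) - (y :: 'a alg_closure) ^ (q ^ 3)"
  by (simp_all add: frob3_eq frob_add_ac frob_diff_ac)

lemma frob_inj_ac: "x ^ q = (y :: 'a alg_closure) ^ q \<Longrightarrow> x = y"
  using frob_diff_ac[of x y] q_ge_4 by simp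

lemma ox_oy_frob3: "ox o' ^ (q ^ 3) = ox o'" "oy o' ^ (q ^ 3) = oy o'"
  using q_ge_4 by (auto simp: ox_def oy_def to_ac_q3 split: option.splits)

text \<open>By the previous cases the Hessian has no root over the ground field, so it has two
  conjugate ones. With \<open>(\<theta>, 1)\<close> in the first slot the form in the other two is
  singular, and its kernel vector in the second slot turns out to be the Frobenius image of a root
  again.\<close>

lemma elliptic_root:
  assumes g: "(A, B, C, D) \<in> dual" and card: "card (zeros (A, B, C, D)) = q\<^sup>2 - q + 1"
  obtains \<theta> \<theta>' :: "'a alg_closure" where "\<theta>' = \<theta> ^ (q ^ 3)" "\<theta>' ^ (q ^ 3) = \<theta>" "\<theta> \<noteq> \<theta>'"
    "\<theta> \<notin> range to_ac" "\<theta>' \<notin> range to_ac"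
    "tri (A, B, C, D) \<theta> 1 (\<theta> ^ q) 1 (\<theta> ^ (q\<^sup>2)) 1 = 0"
proof -
  let ?g = "(A, B, C, D)"
  define h where "h t = (to_ac A + to_ac B * t) * (to_ac C + to_ac D * t)
     - (to_ac B ^ q + to_ac C ^ (q\<^sup>2) * t) * (to_ac B ^ (q\<^sup>2) + to_ac C ^ q * t)" for t
  define c2 where "c2 = to_ac (B * D - C ^ q * C ^ (q\<^sup>2))"
  define c1 where "c1 = to_ac (A * D + B * C - (B ^ q * C ^ q + C ^ (q\<^sup>2) * B ^ (q\<^sup>2)))"
  define c0 where "c0 = to_ac (A * C - B ^ q * B ^ (q\<^sup>2))"
  have h: "h t = c2 * t * t + c1 * t + c0" for t
    by (simp add: h_def c0_def c1_def c2_def algebra_simps)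
  have "B * D \<noteq> C ^ q * C ^ (q\<^sup>2)"
    using card_zeros_hessian_infinity g card by blast
  then have c2: "c2 \<noteq> 0"
    unfolding c2_def to_ac_eq_0_iff by simp
  have "\<exists>t. poly [:c0, c1, c2:] t = 0"
    using c2 by (intro alg_closed_imp_poly_has_root) simp
  then obtain \<theta> where \<theta>: "h \<theta> = 0"
    by (auto simp: h algebra_simps)
  have h_K: "h (to_ac t) \<noteq> 0" for t
  proof -
    have "h (to_ac t) = to_ac (hessian ?g t)"
      by (simp add: h_def hessian_def)
    then show ?thesis
      using card_zeros_hessian_root[OF g] card by (metis to_ac_eq_0_iff)
  qed
  \<comment> \<open>The coefficients of \<open>h\<close> lie in the ground field, so the
    \<open>q^3\<close>-th power map permutes its roots.\<close>
  have h3: "h (t ^ (q ^ 3)) = h t ^ (q ^ 3)" for t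
    by (simp add: h frob3_add_ac power_mult_distrib c0_def c1_def c2_def to_ac_q3 del: to_ac_diff to_ac_add to_ac_mult to_ac_power)
  define \<theta>' where "\<theta>' = \<theta> ^ (q ^ 3)"
  have \<theta>': "h \<theta>' = 0" "h (\<theta>' ^ (q ^ 3)) = 0"
    using \<theta> q_ge_4 by (simp_all add: \<theta>'_def h3)
  have notK: "\<theta> \<notin> range to_ac" "\<theta>' \<notin> range to_ac"
    using h_K \<theta> \<theta>' by auto
  have ne: "\<theta> \<noteq> \<theta>'" "\<theta>' \<noteq> \<theta>' ^ (q ^ 3)"
    using notK unfolding range_to_ac \<theta>'_def by auto
  have roots: "t = \<theta> \<or> t = \<theta>'" if "h t = 0" for t
  proof (rule ccontr)
    assume "\<not> ?thesis"
    then have t: "t \<noteq> \<theta>" "t \<noteq> \<theta>'" by auto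
    have "(t - \<theta>) * (c2 * (t + \<theta>) + c1) = h t - h \<theta>"
      by (simp add: h algebra_simps)
    moreover have "(\<theta>' - \<theta>) * (c2 * (\<theta>' + \<theta>) + c1) = h \<theta>' - h \<theta>"
      by (simp add: h algebra_simps)
    ultimately have "c2 * (t + \<theta>) + c1 = 0" "c2 * (\<theta>' + \<theta>) + c1 = 0"
      using t ne \<theta> \<theta>' that by auto
    moreover have "c2 * (t - \<theta>') = (c2 * (t + \<theta>) + c1) - (c2 * (\<theta>' + \<theta>) + c1)"
      by (simp add: algebra_simps)
    ultimately have "c2 * (t - \<theta>') = 0"
      by simp
    then show False
      using c2 t by simp
  qed
  have \<theta>'3: "\<theta>' ^ (q ^ 3) = \<theta>"
    using roots[OF \<theta>'(2)] ne by auto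
  \<comment> \<open>Entries of the bilinear form left by \<open>(\<theta>, 1)\<close> in the first
    slot; its determinant is \<open>h \<theta>\<close>.\<close>
  define a b c d where "a = to_ac A + to_ac B * \<theta>" and "b = to_ac B ^ q + to_ac C ^ (q\<^sup>2) * \<theta>"
    and "c = to_ac B ^ (q\<^sup>2) + to_ac C ^ q * \<theta>" and "d = to_ac C + to_ac D * \<theta>"
  have tri_\<theta>: "tri ?g \<theta> 1 x1 y1 x2 y2 = a * y1 * y2 + b * x1 * y2 + c * y1 * x2 + d * x1 * x2" for x1 y1 x2 y2
    by (simp add: tri_def a_def b_def c_def d_def algebra_simps)
  have det: "a * d = b * c"
    using \<theta> by (simp add: h_def a_def b_def c_def d_def)
  \<comment> \<open>If \<open>d = 0\<close>, then \<open>\<theta>\<close> lies in the ground field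
    or \<open>C = D = 0\<close>, which contradicts \<open>c2 \<noteq> 0\<close>.\<close>
  have "d \<noteq> 0"
  proof
    assume d: "d = 0"
    have "D = 0"
    proof (rule ccontr)
      assume "D \<noteq> 0"
      have "to_ac D * \<theta> = - to_ac C"
        using d by (simp add: d_def eq_neg_iff_add_eq_0 add.commute)
      then have "\<theta> = - to_ac C / to_ac D"
        using \<open>D \<noteq> 0\<close> by (metis nonzero_mult_div_cancel_left to_ac_eq_0_iff)
      then have "\<theta> = to_ac (- C / D)"
        by simp
      then show False
        using notK by blast
    qed
    moreover from this have "C = 0"
      using d by (simp add: d_def)
    ultimately show False
      using c2 by (simp add: c2_def)
  qed
  \<comment> \<open>The kernel vector is \<open>(- c / d, 1)\<close>; a \<open>q\<close>-th root of
    its first entry can be compared with \<open>\<theta>\<close>.\<close>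
  obtain s where s: "s ^ q = - c / d"
    using nth_root_exists[of q "- c / d"] q_ge_4 by auto
  have ds: "d * s ^ q = - c"
    using s \<open>d \<noteq> 0\<close> by simp
  have V: "tri ?g \<theta> 1 (s ^ q) 1 x y = 0" for x y
  proof -
    have "d * tri ?g \<theta> 1 (s ^ q) 1 x y = y * (a * d + b * (d * s ^ q)) + x * d * (c + d * s ^ q)"
      by (simp add: tri_\<theta> algebra_simps)
    also have "\<dots> = 0"
      unfolding ds using det by simp
    finally show ?thesis
      using \<open>d \<noteq> 0\<close> by simp
  qed
  \<comment> \<open>With \<open>(s^q, 1)\<close> in the second slot, \<open>V\<close> makes
    \<open>(\<theta>, 1)\<close> a kernel vector of the form in the other two slots, whose
    determinant is \<open>h s ^ q\<close>.\<close>
  have "h s ^ q = 0"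
  proof -
    have AD: "to_ac A ^ q = to_ac A" "to_ac D ^ q = to_ac D"
      using g by (auto simp: dual_def to_ac_Fq)
    define \<sigma> where "\<sigma> = s ^ q"
    have k1: "to_ac A + to_ac B ^ q * \<sigma> = - ((to_ac B + to_ac C ^ (q\<^sup>2) * \<sigma>) * \<theta>)"
      using V[of 0 1] by (simp add: tri_def \<sigma>_def eq_neg_iff_add_eq_0 algebra_simps)
    have k2: "to_ac B ^ (q\<^sup>2) + to_ac C * \<sigma> = - ((to_ac C ^ q + to_ac D * \<sigma>) * \<theta>)"
      using V[of 1 0] by (simp add: tri_def \<sigma>_def eq_neg_iff_add_eq_0 algebra_simps)
    have "h s ^ q = (to_ac A + to_ac B ^ q * \<sigma>) * (to_ac C ^ q + to_ac D * \<sigma>)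
        - (to_ac B ^ (q\<^sup>2) + to_ac C * \<sigma>) * (to_ac B + to_ac C ^ (q\<^sup>2) * \<sigma>)"
      by (simp add: h_def frob_add_ac frob_diff_ac power_mult_distrib AD frob_frob_to_ac \<sigma>_def)
    also have "\<dots> = 0"
      unfolding k1 k2 by (simp add: algebra_simps)
    finally show ?thesis .
  qed
  then have s_cases: "s = \<theta> \<or> s = \<theta>'"
    using roots by auto
  \<comment> \<open>A Boolean selects one of the two roots in each slot. Frobenius rotates the
    indices of \<open>w\<close> and negates the one that wraps around.\<close>
  define e where "e i = (if i then \<theta>' else \<theta>)" for i
  have e3: "((e i ^ q) ^ q) ^ q = e (\<not> i)" for i
    using \<theta>'3 by (simp add: e_def \<theta>'_def flip: frob3_eq)
  define w where "w i j k = tri ?g (e i) 1 (e j ^ q) 1 (e k ^ (q\<^sup>2)) 1" for i j k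
  have w_frob: "w (\<not> k) i j = w i j k ^ q" for i j k
    unfolding w_def tri_frob[OF g] frob2_eq e3 by simp
  have w_frob0: "w i j k = 0 \<Longrightarrow> w (\<not> k) i j = 0" for i j k
    using w_frob q_ge_4 by simp
  have w000: "w False False False = 0"
    using s_cases
  proof
    assume "s = \<theta>"
    then show ?thesis
      using V by (simp add: w_def e_def)
  next
    \<comment> \<open>Two Frobenius steps carry the index \<open>(False, True, True)\<close> to
      \<open>(False, False, False)\<close>.\<close>
    assume "s = \<theta>'"
    then have "w False True True = 0"
      using V by (simp add: w_def e_def)
    from w_frob0[OF w_frob0[OF this]] show ?thesis
      by simp
  qed
  then have "tri ?g \<theta> 1 (\<theta> ^ q) 1 (\<theta> ^ (q\<^sup>2)) 1 = 0"
    by (simp add: w_def e_def)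
  with \<theta>'_def \<theta>'3 ne notK that show ?thesis
    by blast
qed

end

subsection \<open>Elliptic coordinates\<close>

text \<open>The vector \<open>(p, r)\<close> and its \<open>q^3\<close>-conjugate serve as a basis
  in which \<open>(ox o', oy o')\<close> has the conjugate coordinates \<open>Z o'\<close> and
  \<open>Z o' ^ (q ^ 3)\<close>. They will represent the two roots of the Hessian, where
  \<open>F_vertex\<close> holds; the scale is fixed by \<open>Z o0 = 1\<close> at a zero of
  \<open>F\<close>.\<close>

locale elliptic = cubic_extension q ty for q :: nat and ty :: "'a::{finite,field} itself" +
  fixes F :: "'a \<times> 'a \<times> 'a \<times> 'a" and p r :: "'a alg_closure" and Z :: "'a option \<Rightarrow> 'a alg_closure"
    and o0 :: "'a option"
  assumes F_dual: "F \<in> dual" and card_zeros_F: "card (zeros F) = q\<^sup>2 - q + 1"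
    and p6: "(p ^ (q ^ 3)) ^ (q ^ 3) = p" and r6: "(r ^ (q ^ 3)) ^ (q ^ 3) = r"
    and ox_Z: "ox o' = p * Z o' + p ^ (q ^ 3) * Z o' ^ (q ^ 3)"
    and oy_Z: "oy o' = r * Z o' + r ^ (q ^ 3) * Z o' ^ (q ^ 3)"
    and Z_nz: "Z o' \<noteq> 0"
    and inj_Z: "inj (\<lambda>o'. Z o' / Z o' ^ (q ^ 3))"
    and F_o0: "ev F o0 = 0" and Z_o0: "Z o0 = 1"
    and F_vertex: "tri F p r (p ^ q) (r ^ q) (p ^ (q\<^sup>2)) (r ^ (q\<^sup>2)) = 0"

context cubic_extension
begin

text \<open>\<open>Z\<close> is the linear form \<open>x - \<theta> y\<close> scaled to 1 at
  \<open>o0\<close>; it never vanishes on the line over the ground field, as \<open>\<theta>\<close>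
  lies outside that field.\<close>

lemma ex_elliptic:
  assumes g: "F \<in> dual" and card: "card (zeros F) = q\<^sup>2 - q + 1"
  shows "\<exists>p r Z o0. elliptic q F p r Z o0"
proof -
  obtain A B C D where F: "F = (A, B, C, D)"
    by (cases F)
  obtain \<theta> \<theta>' :: "'a alg_closure" where \<theta>: "\<theta>' = \<theta> ^ (q ^ 3)" "\<theta>' ^ (q ^ 3) = \<theta>" "\<theta> \<noteq> \<theta>'"
    "\<theta> \<notin> range to_ac" "\<theta>' \<notin> range to_ac"
    "tri F \<theta> 1 (\<theta> ^ q) 1 (\<theta> ^ (q\<^sup>2)) 1 = 0"
    using elliptic_root[of A B C D] g card unfolding F by metis
  have "zeros F \<noteq> {}"
    using card q_size by auto
  then obtain o0 where o0: "ev F o0 = 0"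
    by (auto simp: zeros_def)
  define a where "a t = ox o0 - t * oy o0" for t
  have nz: "ox o' - \<theta> * oy o' \<noteq> 0" "ox o' - \<theta>' * oy o' \<noteq> 0" for o'
    using \<theta>(4,5) by (auto simp: ox_def oy_def split: option.splits)
  then have a_nz: "a \<theta> \<noteq> 0" "a \<theta>' \<noteq> 0"
    by (auto simp: a_def)
  have a3: "a \<theta> ^ (q ^ 3) = a \<theta>'" "a \<theta>' ^ (q ^ 3) = a \<theta>"
    by (simp_all add: a_def frob3_diff_ac power_mult_distrib ox_oy_frob3 \<theta>(2) flip: \<theta>(1))
  define Z where "Z o' = (ox o' - \<theta> * oy o') / a \<theta>" for o'
  have Z3: "Z o' ^ (q ^ 3) = (ox o' - \<theta>' * oy o') / a \<theta>'" for o'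
    by (simp add: Z_def power_divide frob3_diff_ac power_mult_distrib ox_oy_frob3 a3 flip: \<theta>(1))
  \<comment> \<open>Obtained by solving \<open>Z\<close> and its conjugate for \<open>ox\<close> and
    \<open>oy\<close>; \<open>(p, r)\<close> is a multiple of \<open>(\<theta>', 1)\<close>.\<close>
  define p where "p = \<theta>' * a \<theta> / (\<theta>' - \<theta>)"
  define r where "r = a \<theta> / (\<theta>' - \<theta>)"
  have p3: "p ^ (q ^ 3) = \<theta> * a \<theta>' / (\<theta> - \<theta>')" and r3: "r ^ (q ^ 3) = a \<theta>' / (\<theta> - \<theta>')"
    by (simp_all add: p_def r_def power_divide frob3_diff_ac power_mult_distrib a3 \<theta>(2) flip: \<theta>(1))
  have "elliptic q F p r Z o0"
  proof
    show "(p ^ (q ^ 3)) ^ (q ^ 3) = p" "(r ^ (q ^ 3)) ^ (q ^ 3) = r"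
      unfolding p3 r3
      by (simp_all add: p_def r_def power_divide frob3_diff_ac power_mult_distrib a3 \<theta>(2) flip: \<theta>(1))
    show "Z o' \<noteq> 0" for o'
      using nz a_nz by (simp add: Z_def)
    show "Z o0 = 1"
      using a_nz by (simp add: Z_def flip: a_def)
    have combine: "x * a / d * (m / a) + y * b / (- d) * (n / b) = (x * m - y * n) / d"
      if "a \<noteq> 0" "b \<noteq> 0" for x y a b d m n :: "'a alg_closure"
      using that by (simp add: diff_divide_distrib)
    have d: "\<theta>' - \<theta> \<noteq> 0" "\<theta> - \<theta>' = - (\<theta>' - \<theta>)"
      using \<theta>(3) by auto
    show "ox o' = p * Z o' + p ^ (q ^ 3) * Z o' ^ (q ^ 3)" for o'
    proof -
      have "p * Z o' + p ^ (q ^ 3) * Z o' ^ (q ^ 3)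
          = (\<theta>' * (ox o' - \<theta> * oy o') - \<theta> * (ox o' - \<theta>' * oy o')) / (\<theta>' - \<theta>)"
        unfolding p3 Z3 d(2) unfolding p_def Z_def by (rule combine) (use a_nz in auto)
      also have "\<dots> = (\<theta>' - \<theta>) * ox o' / (\<theta>' - \<theta>)"
        by (simp add: algebra_simps)
      finally show ?thesis
        using d(1) by simp
    qed
    show "oy o' = r * Z o' + r ^ (q ^ 3) * Z o' ^ (q ^ 3)" for o'
    proof -
      have "r * Z o' + r ^ (q ^ 3) * Z o' ^ (q ^ 3)
          = ((ox o' - \<theta> * oy o') - (ox o' - \<theta>' * oy o')) / (\<theta>' - \<theta>)"
        unfolding r3 Z3 d(2) unfolding r_def Z_def
        using combine[of "a \<theta>" "a \<theta>'" 1 "\<theta>' - \<theta>" _ 1] a_nz by simp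
      also have "\<dots> = (\<theta>' - \<theta>) * oy o' / (\<theta>' - \<theta>)"
        by (simp add: algebra_simps)
      finally show ?thesis
        using d(1) by simp
    qed
    show "inj (\<lambda>o'. Z o' / Z o' ^ (q ^ 3))"
    proof (rule injI)
      fix o1 o2 assume "Z o1 / Z o1 ^ (q ^ 3) = Z o2 / Z o2 ^ (q ^ 3)"
      then have "(ox o1 - \<theta> * oy o1) * (ox o2 - \<theta>' * oy o2) = (ox o2 - \<theta> * oy o2) * (ox o1 - \<theta>' * oy o1)"
        unfolding Z3 using nz a_nz by (simp add: Z_def frac_eq_eq mult_ac)
      then have "(\<theta>' - \<theta>) * (ox o1 * oy o2 - ox o2 * oy o1) = 0"
        by (simp add: algebra_simps)
      then have "ox o1 * oy o2 = ox o2 * oy o1"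
        using d(1) by simp
      then show "o1 = o2"
        by (auto simp: ox_def oy_def split: option.splits)
    qed
    show "tri F p r (p ^ q) (r ^ q) (p ^ (q\<^sup>2)) (r ^ (q\<^sup>2)) = 0"
    proof -
      \<comment> \<open>Three Frobenius steps rotate the slots once around and carry
        \<open>\<theta>\<close> to \<open>\<theta>'\<close>.\<close>
      have "tri F \<theta>' 1 (\<theta>' ^ q) 1 (\<theta>' ^ (q\<^sup>2)) 1 = ((tri F \<theta> 1 (\<theta> ^ q) 1 (\<theta> ^ (q\<^sup>2)) 1 ^ q) ^ q) ^ q"
        unfolding tri_frob[OF g] \<theta>(1) frob2_eq frob3_eq by simp
      also have "\<dots> = 0"
        by (simp add: \<theta>(6))
      finally have "tri F \<theta>' 1 (\<theta>' ^ q) 1 (\<theta>' ^ (q\<^sup>2)) 1 = 0" .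
      moreover have "p = r * \<theta>'" "r = r * 1"
        by (simp_all add: p_def r_def)
      ultimately show ?thesis
        using tri_homogeneous[of F r \<theta>' 1 "r ^ q" "\<theta>' ^ q" 1 "r ^ (q\<^sup>2)" "\<theta>' ^ (q\<^sup>2)" 1]
        by (simp add: power_mult_distrib)
    qed
  qed (fact g card o0)+
  then show ?thesis by blast
qed

end

context elliptic
begin

text \<open>The index \<open>False\<close> refers to the vector \<open>(p, r)\<close> and \<open>True\<close> to its conjugate under
  the \<open>q\<^sup>3\<close>-th power map; \<open>cv g\<close> collects the coefficients of the trilinear form with respect to
  this basis. Frobenius permutes them in a cycle of length 6, which starts at \<open>\<beta> g\<close>, and one of
  length 2, whose sum is \<open>\<gamma> g\<close>.\<close>

definition ex :: "bool \<Rightarrow> 'a alg_closure" where "ex i = (if i then p ^ (q ^ 3) else p)"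
definition ey :: "bool \<Rightarrow> 'a alg_closure" where "ey i = (if i then r ^ (q ^ 3) else r)"
definition cv :: "'a \<times> 'a \<times> 'a \<times> 'a \<Rightarrow> bool \<Rightarrow> bool \<Rightarrow> bool \<Rightarrow> 'a alg_closure" where
  "cv g i j k = tri g (ex i) (ey i) (ex j ^ q) (ey j ^ q) (ex k ^ (q\<^sup>2)) (ey k ^ (q\<^sup>2))"
definition Zb :: "'a option \<Rightarrow> 'a alg_closure" where "Zb o' = Z o' ^ (q ^ 3)"
definition z :: "'a option \<Rightarrow> 'a alg_closure" where "z o' = Z o' / Zb o'"
definition M :: "'a option \<Rightarrow> 'a alg_closure" where "M o' = Z o' * Zb o' ^ q * Z o' ^ (q\<^sup>2)"
definition \<beta> :: "'a \<times> 'a \<times> 'a \<times> 'a \<Rightarrow> 'a alg_closure" where "\<beta> g = cv g False False True"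
definition \<gamma> :: "'a \<times> 'a \<times> 'a \<times> 'a \<Rightarrow> 'a alg_closure" where
  "\<gamma> g = cv g False True False + cv g True False True"

text \<open>The last slot moves to the front and its power grows from \<open>q^2\<close> to
  \<open>q^3\<close>, which exchanges the basis vector with its conjugate; hence the negated
  index.\<close>

lemma cv_frob: "g \<in> dual \<Longrightarrow> cv g i j k ^ q = cv g (\<not> k) i j"
proof -
  assume g: "g \<in> dual"
  have "((ex k ^ q) ^ q) ^ q = ex (\<not> k)" "((ey k ^ q) ^ q) ^ q = ey (\<not> k)"
    using p6 r6 by (simp_all add: ex_def ey_def flip: frob3_eq)
  then show ?thesis
    unfolding cv_def tri_frob[OF g] frob2_eq by simp
qed

lemma Zb_nz: "Zb o' \<noteq> 0"
  using Z_nz by (simp add: Zb_def)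

lemma ev_expand:
  "to_ac (ev g o') =
     cv g False False False * (Z o' * Z o' ^ q * Z o' ^ (q\<^sup>2)) + cv g False False True * (Z o' * Z o' ^ q * Zb o' ^ (q\<^sup>2))
   + cv g False True False * (Z o' * Zb o' ^ q * Z o' ^ (q\<^sup>2)) + cv g False True True * (Z o' * Zb o' ^ q * Zb o' ^ (q\<^sup>2))
   + cv g True False False * (Zb o' * Z o' ^ q * Z o' ^ (q\<^sup>2)) + cv g True False True * (Zb o' * Z o' ^ q * Zb o' ^ (q\<^sup>2))
   + cv g True True False * (Zb o' * Zb o' ^ q * Z o' ^ (q\<^sup>2)) + cv g True True True * (Zb o' * Zb o' ^ q * Zb o' ^ (q\<^sup>2))"
proof -
  have x: "ox o' = Z o' * p + Zb o' * p ^ (q ^ 3)" and y: "oy o' = Z o' * r + Zb o' * r ^ (q ^ 3)"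
    using ox_Z[of o'] oy_Z[of o'] by (simp_all add: Zb_def mult.commute)
  have x1: "ox o' ^ q = Z o' ^ q * p ^ q + Zb o' ^ q * (p ^ (q ^ 3)) ^ q"
    and y1: "oy o' ^ q = Z o' ^ q * r ^ q + Zb o' ^ q * (r ^ (q ^ 3)) ^ q"
    by (simp_all add: x y frob_add_ac power_mult_distrib)
  have x2: "ox o' ^ (q\<^sup>2) = Z o' ^ (q\<^sup>2) * p ^ (q\<^sup>2) + Zb o' ^ (q\<^sup>2) * (p ^ (q ^ 3)) ^ (q\<^sup>2)"
    and y2: "oy o' ^ (q\<^sup>2) = Z o' ^ (q\<^sup>2) * r ^ (q\<^sup>2) + Zb o' ^ (q\<^sup>2) * (r ^ (q ^ 3)) ^ (q\<^sup>2)"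
    by (simp_all add: x y frob2_add_ac power_mult_distrib)
  show ?thesis
    unfolding tri_ev x2 y2 x1 y1 unfolding x y tri_linear cv_def ex_def ey_def
    by (simp only: if_True if_False algebra_simps)
qed

text \<open>The vertex condition is the first equation; the Frobenius cycle of length 6 spreads it
  to the others.\<close>

lemma cv_F:
  "cv F False False False = 0" "cv F True False False = 0" "cv F True True False = 0"
  "cv F True True True = 0" "cv F False True True = 0" "cv F False False True = 0"
proof -
  have *: "cv F i j k = 0 \<Longrightarrow> cv F (\<not> k) i j = 0" for i j k
    using cv_frob[OF F_dual, of i j k] by simp
  show 0: "cv F False False False = 0"
    using F_vertex by (simp add: cv_def ex_def ey_def)
  from *[OF 0] show 1: "cv F True False False = 0" by simp
  from *[OF 1] show 2: "cv F True True False = 0" by simp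
  from *[OF 2] show 3: "cv F True True True = 0" by simp
  from *[OF 3] show 4: "cv F False True True = 0" by simp
  from *[OF 4] show 5: "cv F False False True = 0" by simp
qed

lemma M_nz: "M o' \<noteq> 0"
  using Z_nz Zb_nz by (simp add: M_def)

lemma M_frob: "M o' ^ q = Zb o' * Z o' ^ q * Zb o' ^ (q\<^sup>2)"
proof -
  have "(Z o' ^ (q\<^sup>2)) ^ q = Zb o'"
    by (simp add: Zb_def frob3_eq frob2_eq)
  then show ?thesis
    by (simp add: M_def power_mult_distrib frob2_eq)
qed

text \<open>All monomials equal 1 at \<open>o0\<close>, where \<open>F\<close> vanishes, so the two
  remaining coefficients cancel.\<close>

lemma cv_F_neg: "cv F True False True = - cv F False True False"
  using ev_expand[of F o0] F_o0 by (simp add: cv_F Z_o0 Zb_def eq_neg_iff_add_eq_0 add.commute)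

text \<open>Only the monomials \<open>M\<close> and \<open>M^q\<close> survive in \<open>F\<close>,
  so its zeros are the points where Frobenius fixes \<open>M\<close>.\<close>

lemma ev_F: "to_ac (ev F o') = cv F False True False * (M o' - M o' ^ q)"
  unfolding ev_expand M_frob by (simp add: cv_F cv_F_neg M_def algebra_simps)

lemma zeros_F_neq_UNIV: "zeros F \<noteq> UNIV"
proof
  assume "zeros F = UNIV"
  then have "card (range (Some :: 'a \<Rightarrow> _)) \<le> card (zeros F)"
    by (intro card_mono) auto
  then show False
    using card_zeros_F q_size by (simp add: card_image card_UNIV)
qed

lemma F_nz: "cv F False True False \<noteq> 0"
  using ev_F zeros_F_neq_UNIV by (auto simp: zeros_def)

lemma M_fixed: "o' \<in> zeros F \<Longrightarrow> M o' ^ q = M o'"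
  using ev_F[of o'] F_nz by (simp add: zeros_def)

lemma z_nz: "z o' \<noteq> 0"
  using Z_nz Zb_nz by (simp add: z_def)

lemma z_inj: "inj z"
  using inj_Z unfolding z_def Zb_def .

text \<open>This is \<open>M^q = M\<close> written in the quotient \<open>z\<close>; iterating it
  makes all conjugates of \<open>z\<close> monomials in \<open>z\<close> and
  \<open>z^q\<close>.\<close>

lemma z_frob2: "o' \<in> zeros F \<Longrightarrow> z o' ^ (q\<^sup>2) * z o' = z o' ^ q"
  using M_fixed[of o'] Zb_nz[of o'] unfolding M_frob
  by (simp add: M_def z_def power_divide field_simps)

lemma z_power: "o' \<in> zeros F \<Longrightarrow> z o' ^ (q\<^sup>2 - q + 1) = 1"
proof -
  assume o': "o' \<in> zeros F"
  have "q \<le> q\<^sup>2"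
    using q_ge_4 by (simp add: power2_eq_square)
  then have "z o' ^ (q\<^sup>2 - q + 1) * z o' ^ q = z o' ^ (q\<^sup>2) * z o'"
    by (simp flip: power_add power_Suc2)
  then show ?thesis
    using z_frob2[OF o'] z_nz[of o'] by simp
qed

lemma \<beta>_diff: "\<beta> (g - h) = \<beta> g - \<beta> h" and \<gamma>_diff: "\<gamma> (g - h) = \<gamma> g - \<gamma> h"
  and \<beta>_scale: "l \<in> Fqa \<Longrightarrow> \<beta> (scale4 l g) = to_ac l * \<beta> g"
  by (simp_all add: \<beta>_def \<gamma>_def cv_def tri_diff tri_scale algebra_simps)

lemma \<beta>_frob:
  assumes "g \<in> dual"
  shows "\<beta> g ^ q = cv g False False False" "(\<beta> g ^ q) ^ q = cv g True False False"
    "((\<beta> g ^ q) ^ q) ^ q = cv g True True False" "(((\<beta> g ^ q) ^ q) ^ q) ^ q = cv g True True True"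
    "((((\<beta> g ^ q) ^ q) ^ q) ^ q) ^ q = cv g False True True"
    "(((((\<beta> g ^ q) ^ q) ^ q) ^ q) ^ q) ^ q = \<beta> g"
  by (simp_all add: \<beta>_def cv_frob[OF assms])

lemma \<gamma>_frob: "g \<in> dual \<Longrightarrow> \<gamma> g ^ q = \<gamma> g"
  by (simp add: \<gamma>_def frob_add_ac cv_frob)

text \<open>The bracket is \<open>z z^q (\<gamma> + Tr(\<beta> z))\<close> with denominators
  cleared: the further conjugates of \<open>z\<close> are \<open>z^q\<close>, \<open>z^q/z\<close>,
  \<open>1/z\<close>, \<open>1/z^q\<close> and \<open>z/z^q\<close>.\<close>

lemma ev_coords:
  assumes o': "o' \<in> zeros F" and g: "g \<in> dual"
  shows "z o' * z o' ^ q * to_ac (ev g o') = M o' *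
    (\<gamma> g * z o' * z o' ^ q + \<beta> g * (z o')\<^sup>2 * z o' ^ q + \<beta> g ^ q * z o' * (z o' ^ q)\<^sup>2
     + (\<beta> g ^ q) ^ q * (z o' ^ q)\<^sup>2 + ((\<beta> g ^ q) ^ q) ^ q * z o' ^ q
     + (((\<beta> g ^ q) ^ q) ^ q) ^ q * z o' + ((((\<beta> g ^ q) ^ q) ^ q) ^ q) ^ q * (z o')\<^sup>2)"
proof -
  define u v w where "u = z o'" and "v = z o' ^ q" and "w = z o' ^ (q\<^sup>2)"
  define b0 b1 b2 where "b0 = Zb o'" and "b1 = Zb o' ^ q" and "b2 = Zb o' ^ (q\<^sup>2)"
  have nz: "u \<noteq> 0" "v \<noteq> 0" "w \<noteq> 0"
    using z_nz by (auto simp: u_def v_def w_def)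
  have wu: "w * u = v"
    using z_frob2[OF o'] by (simp add: u_def v_def w_def)
  have Z: "Z o' = u * b0" "Z o' ^ q = v * b1" "Z o' ^ (q\<^sup>2) = w * b2"
    using Zb_nz[of o'] by (simp_all add: u_def v_def w_def b0_def b1_def b2_def z_def power_divide)
  have M: "M o' = v * b0 * b1 * b2"
    unfolding M_def Z(3) unfolding Z(1) b1_def[symmetric] wu[symmetric] by simp
  have "u * v * to_ac (ev g o') = M o' * (\<gamma> g * u * v + cv g False False True * u\<^sup>2 * v
      + cv g False False False * u * v\<^sup>2 + cv g True False False * v\<^sup>2 + cv g True True False * v
      + cv g True True True * u + cv g False True True * u\<^sup>2)"
    unfolding ev_expand M \<gamma>_def unfolding Z(2,3) b1_def[symmetric] b2_def[symmetric]
    unfolding Z(1) b0_def[symmetric]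
    by (rule coords_identity[OF wu])
  \<comment> \<open>The deepest power of \<open>\<beta> g\<close> is rewritten first, because the
    shallower ones occur inside it.\<close>
  then show ?thesis
    unfolding u_def v_def \<beta>_frob(5)[OF g] unfolding \<beta>_frob(4)[OF g] unfolding \<beta>_frob(3)[OF g]
    unfolding \<beta>_frob(2)[OF g] unfolding \<beta>_frob(1)[OF g] unfolding \<beta>_def .
qed

text \<open>Only the monomials \<open>M\<close> and \<open>M^q\<close> remain, with opposite
  coefficients, so all values are proportional to those of \<open>F\<close>. The factor is a
  quotient of values, hence lies in \<open>Fqa\<close>.\<close>

lemma kernel_coords:
  assumes g: "g \<in> dual" and "\<beta> g = 0" and "\<gamma> g = 0"
  obtains l where "l \<in> Fqa" "g = scale4 l F"
proof -
  define e where "e = cv g False True False / cv F False True False"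
  have "cv g True False True = - cv g False True False"
    using assms(3) by (simp add: \<gamma>_def eq_neg_iff_add_eq_0 add.commute)
  then have ev: "to_ac (ev g o') = e * to_ac (ev F o')" for o'
    unfolding ev_F unfolding ev_expand M_frob using \<beta>_frob[OF g] assms(2) F_nz
    by (simp add: \<beta>_def[symmetric] e_def M_def algebra_simps)
  obtain o1 where o1: "ev F o1 \<noteq> 0"
    using zeros_F_neq_UNIV by (auto simp: zeros_def)
  define l where "l = ev g o1 / ev F o1"
  have l: "l \<in> Fqa"
    unfolding l_def by (intro Fq_divide ev_in_Fq g F_dual)
  have "e = to_ac l"
    using ev[of o1] o1 by (simp add: l_def)
  then have "to_ac (ev g o') = to_ac (l * ev F o')" for o'
    using ev by simp
  then have "ev g o' = l * ev F o'" for o'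
    by (simp only: to_ac_eq_iff)
  then have "ev (g - scale4 l F) o' = 0" for o'
    by (simp add: ev_diff ev_scale l)
  then have "g - scale4 l F = 0"
    by (rule ev_eq_0_imp)
  then show ?thesis
    using that l by simp
qed

subsection \<open>Common zeros of two functionals\<close>

text \<open>Adding a multiple of \<open>F\<close> does not change a functional on the hyperplane of
  \<open>F\<close>, so independence below is taken modulo this set.\<close>

definition FqF :: "('a \<times> 'a \<times> 'a \<times> 'a) set" where "FqF = (\<lambda>l. scale4 l F) ` Fqa"

lemma kernel_coords_FqF: "g \<in> dual \<Longrightarrow> \<beta> g = 0 \<Longrightarrow> \<gamma> g = 0 \<Longrightarrow> g \<in> FqF"
  unfolding FqF_def by (metis kernel_coords imageI)

lemma FqF_coords: "g \<in> FqF \<Longrightarrow> \<beta> g = 0"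
  unfolding FqF_def by (auto simp: \<beta>_scale) (simp add: \<beta>_def cv_F)

lemma card_FqF: "card FqF \<le> q"
  unfolding FqF_def using card_image_le[of Fqa "\<lambda>l. scale4 l F"] card_Fq by simp

text \<open>On zeros of \<open>F\<close> the value is then \<open>\<gamma> g\<close> up to a nonzero
  factor, and \<open>\<gamma> g = 0\<close> would make \<open>g\<close> a multiple of
  \<open>F\<close>.\<close>

lemma ev_nonzero_if_\<beta>_0:
  assumes "g \<in> dual" "g \<notin> FqF" "\<beta> g = 0" "o' \<in> zeros F"
  shows "ev g o' \<noteq> 0"
proof
  assume "ev g o' = 0"
  then have "\<gamma> g = 0"
    using ev_coords[OF assms(4,1)] assms(3) M_nz[of o'] z_nz[of o'] by simp
  with kernel_coords_FqF assms show False by blast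
qed

text \<open>If the quotient of the \<open>\<beta>\<close> values lies in \<open>Fqa\<close>, some
  combination has \<open>\<beta> = 0\<close> and no zeros. Otherwise \<open>v = z^q\<close> is
  eliminated from two quadratics, leaving a nonzero polynomial of degree at most 6 in
  \<open>z\<close>.\<close>

lemma card_common_zeros:
  assumes g1: "g1 \<in> dual" and g2: "g2 \<in> dual" and n1: "g1 \<notin> FqF"
    and n2: "\<And>l. l \<in> Fqa \<Longrightarrow> g2 - scale4 l g1 \<notin> FqF"
  shows "card {o' \<in> zeros F. ev g1 o' = 0 \<and> ev g2 o' = 0} \<le> 6"
proof (cases "\<beta> g1 = 0")
  case True
  then have "{o' \<in> zeros F. ev g1 o' = 0 \<and> ev g2 o' = 0} = {}"
    using ev_nonzero_if_\<beta>_0[OF g1 n1] by blast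
  then show ?thesis
    by (simp only: card.empty)
next
  case False
  define \<rho> where "\<rho> = \<beta> g2 / \<beta> g1"
  have \<beta>2: "\<beta> g2 = \<rho> * \<beta> g1"
    using False by (simp add: \<rho>_def)
  show ?thesis
  proof (cases "\<rho> ^ q = \<rho>")
    case True
    then obtain l where l: "l \<in> Fqa" "\<rho> = to_ac l"
      by (rule Fq_ac_cases)
    have "\<beta> (g2 - scale4 l g1) = 0"
      using \<beta>2 l by (simp add: \<beta>_diff \<beta>_scale)
    then have "ev (g2 - scale4 l g1) o' \<noteq> 0" if "o' \<in> zeros F" for o'
      using ev_nonzero_if_\<beta>_0 n2 l g1 g2 that by (simp add: dual_diff dual_scale)
    then have "{o' \<in> zeros F. ev g1 o' = 0 \<and> ev g2 o' = 0} = {}"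
      using l by (force simp: ev_diff ev_scale)
    then show ?thesis
      by (simp only: card.empty)
  next
    case False': False
    \<comment> \<open>\<open>b g n\<close> is the \<open>q^n\<close>-th power of
      \<open>\<beta> g\<close>. A zero of \<open>g\<close> satisfies
      \<open>A v^2 + B v + u C = 0\<close> with \<open>A\<close>, \<open>B\<close>, \<open>C\<close>
      polynomials in \<open>u = z\<close>; \<open>R\<close> is the resultant of two such equations
      divided by \<open>u\<close>.\<close>
    define b where "b g n = ((\<lambda>x. x ^ q) ^^ n) (\<beta> g)" for g n
    define A where "A g = [:b g 2, b g 1:]" for g
    define B where "B g = [:b g 3, \<gamma> g, b g 0:]" for g
    define C where "C g = [:b g 4, b g 5:]" for g
    define R where "R = [:0, 1:] * (A g1 * C g2 - A g2 * C g1)\<^sup>2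
        - (A g1 * B g2 - A g2 * B g1) * (B g1 * C g2 - B g2 * C g1)"
    have b_nz: "b g1 n \<noteq> 0" for n
      using False by (induction n) (auto simp: b_def)
    have b2: "b g2 n = ((\<lambda>x. x ^ q) ^^ n) \<rho> * b g1 n" for n
      by (induction n) (simp_all add: b_def \<beta>2 power_mult_distrib)
    have \<rho>n: "((\<lambda>x. x ^ q) ^^ Suc n) \<rho> \<noteq> ((\<lambda>x. x ^ q) ^^ n) \<rho>" for n
      by (induction n) (use False' frob_inj_ac in auto)
    have wronskian: "b g1 n * b g2 (Suc n) - b g2 n * b g1 (Suc n) \<noteq> 0" for n
    proof -
      have "b g1 n * b g2 (Suc n) - b g2 n * b g1 (Suc n)
          = b g1 n * b g1 (Suc n) * (((\<lambda>x. x ^ q) ^^ Suc n) \<rho> - ((\<lambda>x. x ^ q) ^^ n) \<rho>)"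
        unfolding b2 by (simp only: algebra_simps)
      then show ?thesis
        using b_nz \<rho>n by simp
    qed
    \<comment> \<open>At \<open>u = 0\<close> a product of two determinants in conjugates of the
      \<open>\<beta>\<close> values is left; both are nonzero because Frobenius moves
      \<open>\<rho>\<close>.\<close>
    have "poly R 0 = - (b g1 2 * b g2 3 - b g2 2 * b g1 3) * (b g1 3 * b g2 4 - b g2 3 * b g1 4)"
      by (simp add: R_def A_def B_def C_def algebra_simps)
    then have "poly R 0 \<noteq> 0"
      using wronskian[of 2] wronskian[of 3] by (simp add: eval_nat_numeral)
    then have "R \<noteq> 0"
      by auto
    have deg: "degree (A g) \<le> 1" "degree (B g) \<le> 2" "degree (C g) \<le> 1" for g
      by (auto simp: A_def B_def C_def)
    have mult: "degree (x * y) \<le> m + n" if "degree x \<le> m" "degree y \<le> n" for x y :: "'a alg_closure poly" and m n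
      using that degree_mult_le[of x y] by linarith
    have "degree (A g1 * C g2 - A g2 * C g1) \<le> 1 + 1" "degree (A g1 * B g2 - A g2 * B g1) \<le> 1 + 2"
      "degree (B g1 * C g2 - B g2 * C g1) \<le> 2 + 1"
      using deg by (intro degree_diff_le mult; simp)+
    then have "degree ([:0, 1:] * (A g1 * C g2 - A g2 * C g1)\<^sup>2) \<le> 1 + ((1 + 1) + (1 + 1))"
      "degree ((A g1 * B g2 - A g2 * B g1) * (B g1 * C g2 - B g2 * C g1)) \<le> (1 + 2) + (2 + 1)"
      unfolding power2_eq_square by (intro mult; simp)+
    then have "degree R \<le> 6"
      unfolding R_def by (intro degree_diff_le) auto
    have "card {o' \<in> zeros F. ev g1 o' = 0 \<and> ev g2 o' = 0} \<le> card {x. poly R x = 0}"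
    proof (rule card_inj_on_le[where f = z])
      show "inj_on z {o' \<in> zeros F. ev g1 o' = 0 \<and> ev g2 o' = 0}"
        using z_inj by (rule inj_on_subset) simp
      show "finite {x. poly R x = 0}"
        using \<open>R \<noteq> 0\<close> by (rule poly_roots_finite)
      show "z ` {o' \<in> zeros F. ev g1 o' = 0 \<and> ev g2 o' = 0} \<subseteq> {x. poly R x = 0}"
      proof (rule image_subsetI)
        fix o' assume "o' \<in> {o' \<in> zeros F. ev g1 o' = 0 \<and> ev g2 o' = 0}"
        then have o': "o' \<in> zeros F" "ev g1 o' = 0" "ev g2 o' = 0"
          by auto
        define u v where "u = z o'" and "v = z o' ^ q"
        have nz: "u \<noteq> 0" "v \<noteq> 0"
          using z_nz by (auto simp: u_def v_def)
        have eq: "poly (A g) u * v\<^sup>2 + poly (B g) u * v + u * poly (C g) u = 0"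
          if g: "g \<in> dual" and "ev g o' = 0" for g
        proof -
          have "\<gamma> g * u * v + \<beta> g * u\<^sup>2 * v + \<beta> g ^ q * u * v\<^sup>2
             + (\<beta> g ^ q) ^ q * v\<^sup>2 + ((\<beta> g ^ q) ^ q) ^ q * v
             + (((\<beta> g ^ q) ^ q) ^ q) ^ q * u + ((((\<beta> g ^ q) ^ q) ^ q) ^ q) ^ q * u\<^sup>2 = 0"
            using ev_coords[OF o'(1) g] that(2) M_nz[of o'] by (simp add: u_def v_def)
          then show ?thesis
            by (simp add: A_def B_def C_def b_def eval_nat_numeral algebra_simps)
        qed
        have "u * poly R u = (poly (A g1) u * (u * poly (C g2) u) - poly (A g2) u * (u * poly (C g1) u))\<^sup>2
          - (poly (A g1) u * poly (B g2) u - poly (A g2) u * poly (B g1) u)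
            * (poly (B g1) u * (u * poly (C g2) u) - poly (B g2) u * (u * poly (C g1) u))"
          by (simp add: R_def algebra_simps power2_eq_square)
        also have "\<dots> = 0"
          using common_root_resultant[OF eq[OF g1 o'(2)] eq[OF g2 o'(3)] nz(2)] by simp
        finally have "u * poly R u = 0" .
        then show "z o' \<in> {x. poly R x = 0}"
          using nz by (simp add: u_def)
      qed
    qed
    also have "\<dots> \<le> 6"
      using card_poly_roots_bound[OF \<open>R \<noteq> 0\<close>] \<open>degree R \<le> 6\<close> by linarith
    finally show ?thesis .
  qed
qed

text \<open>The equation in \<open>z\<close> has degree at most \<open>2 q + 1\<close>, less than
  the number of zeros of \<open>F\<close>. So the polynomial is zero, and its coefficients at
  \<open>q + 1\<close> and \<open>q + 2\<close> are \<open>\<gamma> g\<close> and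
  \<open>\<beta> g\<close>.\<close>

lemma vanishing_on_zeros:
  assumes g: "g \<in> dual" and "zeros F \<subseteq> zeros g"
  shows "g \<in> FqF"
proof -
  define P where "P = monom (\<gamma> g) (q + 1) + monom (\<beta> g) (q + 2) + monom (\<beta> g ^ q) (2 * q + 1)
     + monom ((\<beta> g ^ q) ^ q) (2 * q) + monom (((\<beta> g ^ q) ^ q) ^ q) q
     + monom ((((\<beta> g ^ q) ^ q) ^ q) ^ q) 1 + monom (((((\<beta> g ^ q) ^ q) ^ q) ^ q) ^ q) 2"
  have "P = 0"
  proof (rule ccontr)
    assume "P \<noteq> 0"
    have "degree P \<le> 2 * q + 1"
      unfolding P_def using q_ge_4
      by (intro degree_add_le order.trans[OF degree_monom_le]) auto
    have "card (zeros F) \<le> card {x. poly P x = 0}"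
    proof (rule card_inj_on_le[where f = z])
      show "inj_on z (zeros F)"
        using z_inj by (rule inj_on_subset) simp
      show "finite {x. poly P x = 0}"
        using \<open>P \<noteq> 0\<close> by (rule poly_roots_finite)
      show "z ` zeros F \<subseteq> {x. poly P x = 0}"
      proof (rule image_subsetI)
        fix o' assume o': "o' \<in> zeros F"
        then have "ev g o' = 0"
          using assms(2) by (auto simp: zeros_def)
        then show "z o' \<in> {x. poly P x = 0}"
          using ev_coords[OF o' g] M_nz[of o']
          by (simp add: P_def poly_monom power_add power_mult[of _ q 2] mult.commute[of 2 q] mult_ac power2_eq_square)
      qed
    qed
    then have "q\<^sup>2 - q + 1 \<le> 2 * q + 1"
      using card_poly_roots_bound[OF \<open>P \<noteq> 0\<close>] \<open>degree P \<le> _\<close> card_zeros_F by linarith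
    moreover have "4 * q \<le> q\<^sup>2"
      using q_ge_4 by (simp add: power2_eq_square)
    ultimately show False
      using q_ge_4 by linarith
  qed
  then have "coeff P (q + 1) = 0" "coeff P (q + 2) = 0"
    by simp_all
  then have "\<gamma> g = 0" "\<beta> g = 0"
    using q_ge_4 by (simp_all add: P_def coeff_monom)
  then show ?thesis
    using kernel_coords_FqF g by blast
qed

text \<open>\<open>FqF\<close> has at most \<open>q\<close> elements and its sum with the multiples
  of \<open>g1\<close> at most \<open>q^2\<close>, both fewer than \<open>q^3\<close>.\<close>

lemma choose_two:
  assumes "N \<subseteq> dual" and "q ^ 3 \<le> card N"
  obtains g1 g2 where "g1 \<in> N" "g2 \<in> N" "g1 \<notin> FqF" "\<And>l. l \<in> Fqa \<Longrightarrow> g2 - scale4 l g1 \<notin> FqF"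
proof -
  have q3: "q < q ^ 3" "q\<^sup>2 < q ^ 3"
    using q_ge_4 power_strict_increasing[of 1 3 q] power_strict_increasing[of 2 3 q] by simp_all
  have "\<not> N \<subseteq> FqF"
    using card_mono[of FqF N] card_FqF assms(2) q3 by auto
  then obtain g1 where g1: "g1 \<in> N" "g1 \<notin> FqF"
    by blast
  let ?S = "(\<lambda>(l, h). h + scale4 l g1) ` (Fqa \<times> FqF)"
  have "card ?S \<le> card (Fqa \<times> FqF)"
    by (rule card_image_le) simp
  also have "\<dots> \<le> q\<^sup>2"
    using card_FqF by (simp add: card_cartesian_product card_Fq power2_eq_square)
  finally have "\<not> N \<subseteq> ?S"
    using card_mono[of ?S N] assms(2) q3 by auto
  then obtain g2 where g2: "g2 \<in> N" "g2 \<notin> ?S"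
    by blast
  have "g2 - scale4 l g1 \<notin> FqF" if "l \<in> Fqa" for l
  proof
    assume "g2 - scale4 l g1 \<in> FqF"
    then have "(g2 - scale4 l g1) + scale4 l g1 \<in> ?S"
      using that by (intro image_eqI[of _ _ "(l, g2 - scale4 l g1)"]) auto
    then show False
      using g2 by simp
  qed
  with g1 g2 that show ?thesis by blast
qed

subsection \<open>Functionals with many zeros\<close>

text \<open>Five zeros of \<open>F\<close> lie on a pencil of \<open>q + 1\<close> functionals. If
  none of these had eight zeros, each would take at most two of the other \<open>q^2 - q - 4\<close>
  zeros, but \<open>2 (q + 1) < q^2 - q - 4\<close> once \<open>q \<ge> 5\<close>.\<close>

lemma ex_eight_zeros_large:
  assumes "q \<ge> 5"
  shows "\<exists>g\<in>dual. g \<notin> FqF \<and> 8 \<le> card {o' \<in> zeros F. ev g o' = 0}"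
proof (rule ccontr)
  assume "\<not> ?thesis"
  then have few: "card {o' \<in> zeros F. ev g o' = 0} \<le> 7" if "g \<in> dual" "g \<notin> FqF" for g
    using that by force
  have "5 \<le> card (zeros F)"
    using card_zeros_F q_size by linarith
  then obtain S where S: "S \<subseteq> zeros F" "card S = 5" "finite S"
    by (rule obtain_subset_with_card_n)
  obtain os where os: "set os = S" "distinct os"
    using finite_distinct_list[OF S(3)] by blast
  have len: "length (map ovec os) = 5"
    using os S(2) distinct_card by fastforce
  have "q ^ 8 \<le> card (annih (set (map ovec os))) * q ^ 5"
    using card_annih[of "map ovec os"] ovec_in_U1 len by auto
  then have "q ^ 5 * q ^ 3 \<le> q ^ 5 * card (annih (set (map ovec os)))"
    by (simp add: mult.commute flip: power_add)
  then have large: "q ^ 3 \<le> card (annih (set (map ovec os)))"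
    using q_ge_4 unfolding mult_le_cancel1 by simp
  have "annih (set (map ovec os)) \<subseteq> dual"
    by (auto simp: annih_def)
  with large obtain g1 g2 where g: "g1 \<in> annih (set (map ovec os))" "g2 \<in> annih (set (map ovec os))"
    "g1 \<notin> FqF" "\<And>l. l \<in> Fqa \<Longrightarrow> g2 - scale4 l g1 \<notin> FqF"
    using choose_two by blast
  have g_dual: "g1 \<in> dual" "g2 \<in> dual" and g_S: "\<And>o'. o' \<in> S \<Longrightarrow> ev g1 o' = 0 \<and> ev g2 o' = 0"
    using g(1,2) os(1) by (auto simp: annih_def ev_def)
  \<comment> \<open>Every further zero of \<open>F\<close> is a zero of one of the \<open>q + 1\<close> members of this pencil.\<close>
  define T where "T = insert g1 ((\<lambda>l. g2 - scale4 l g1) ` Fqa)"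
  have T: "h \<in> dual \<and> h \<notin> FqF \<and> (\<forall>o'\<in>S. ev h o' = 0)" if "h \<in> T" for h
    using that g(3,4) g_dual g_S by (auto simp: T_def dual_diff dual_scale ev_diff ev_scale)
  have "card T \<le> q + 1"
  proof -
    have "card T \<le> Suc (card ((\<lambda>l. g2 - scale4 l g1) ` Fqa))"
      unfolding T_def by (rule card_insert_le_m1) auto
    also have "\<dots> \<le> Suc (card Fqa)"
      by (simp add: card_image_le)
    finally show ?thesis
      by (simp add: card_Fq)
  qed
  have "zeros F - S \<subseteq> (\<Union>h\<in>T. {o' \<in> zeros F. ev h o' = 0} - S)"
  proof
    fix o' assume o': "o' \<in> zeros F - S"
    show "o' \<in> (\<Union>h\<in>T. {o' \<in> zeros F. ev h o' = 0} - S)"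
    proof (cases "ev g1 o' = 0")
      case True
      then show ?thesis
        using o' by (auto simp: T_def)
    next
      case False
      define l where "l = ev g2 o' / ev g1 o'"
      have "l \<in> Fqa"
        unfolding l_def using g_dual by (intro Fq_divide ev_in_Fq)
      then have "ev (g2 - scale4 l g1) o' = 0" "g2 - scale4 l g1 \<in> T"
        using False by (auto simp: ev_diff ev_scale l_def T_def)
      then show ?thesis
        using o' by blast
    qed
  qed
  then have "card (zeros F - S) \<le> card (\<Union>h\<in>T. {o' \<in> zeros F. ev h o' = 0} - S)"
    by (intro card_mono) auto
  also have "\<dots> \<le> (\<Sum>h\<in>T. card ({o' \<in> zeros F. ev h o' = 0} - S))"
    by (rule card_UN_le) simp
  also have "\<dots> \<le> (\<Sum>h\<in>T. 2)"
  proof (rule sum_mono)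
    fix h assume h: "h \<in> T"
    have "card ({o' \<in> zeros F. ev h o' = 0} - S) = card {o' \<in> zeros F. ev h o' = 0} - card S"
      using T[OF h] S by (intro card_Diff_subset) auto
    then show "card ({o' \<in> zeros F. ev h o' = 0} - S) \<le> 2"
      using few[of h] T[OF h] S(2) by simp
  qed
  also have "\<dots> \<le> 2 * (q + 1)"
    using \<open>card T \<le> q + 1\<close> by simp
  finally have "card (zeros F - S) \<le> 2 * (q + 1)" .
  moreover have "card (zeros F - S) = q\<^sup>2 - q + 1 - 5"
    using S card_zeros_F by (simp add: card_Diff_subset)
  moreover have "5 * q \<le> q\<^sup>2"
    using assms by (simp add: power2_eq_square)
  ultimately have "5 * q \<le> q\<^sup>2" "q\<^sup>2 - q + 1 - 5 \<le> 2 * (q + 1)"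
    by auto
  then show False
    using assms by (simp add: diff_le_eq)
qed

definition tr6 :: "'a alg_closure \<Rightarrow> 'a alg_closure" where
  "tr6 x = x + x ^ q + (x ^ q) ^ q + ((x ^ q) ^ q) ^ q + (((x ^ q) ^ q) ^ q) ^ q + ((((x ^ q) ^ q) ^ q) ^ q) ^ q"

lemma tr6_add: "tr6 (x + y) = tr6 x + tr6 y"
  by (simp add: tr6_def frob_add_ac algebra_simps)

text \<open>On zeros of \<open>F\<close> the conjugates of \<open>u = z\<close> are
  \<open>v\<close>, \<open>v/u\<close>, \<open>1/u\<close>, \<open>1/v\<close>, \<open>u/v\<close>,
  so the trace equation is the bracket of \<open>ev_coords\<close> divided by
  \<open>u v\<close>.\<close>

lemma ev_tr6:
  assumes "o' \<in> zeros F" and g: "g \<in> dual" and zero: "\<gamma> g + tr6 (\<beta> g * z o') = 0"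
  shows "ev g o' = 0"
proof -
  define u v where "u = z o'" and "v = z o' ^ q"
  have nz: "u \<noteq> 0" "v \<noteq> 0"
    using z_nz by (auto simp: u_def v_def)
  have f: "u ^ q = v" "v ^ q = v / u"
    using z_frob2[OF assms(1)] nz by (simp_all add: u_def v_def frob2_eq eq_divide_eq)
  have f': "(v / u) ^ q = 1 / u" "(1 / u) ^ q = 1 / v" "(1 / v) ^ q = u / v"
    using nz by (simp_all add: power_divide f)
  have "u * v * (c + (b0 * u + b1 * v + b2 * (v / u) + b3 * (1 / u) + b4 * (1 / v) + b5 * (u / v)))
      = c * u * v + b0 * u\<^sup>2 * v + b1 * u * v\<^sup>2 + b2 * v\<^sup>2 + b3 * v + b4 * u + b5 * u\<^sup>2" for c b0 b1 b2 b3 b4 b5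
    using nz by (simp add: distrib_left power2_eq_square mult_ac)
  then have "u * v * (\<gamma> g + tr6 (\<beta> g * u)) = \<gamma> g * u * v + \<beta> g * u\<^sup>2 * v + \<beta> g ^ q * u * v\<^sup>2
     + (\<beta> g ^ q) ^ q * v\<^sup>2 + ((\<beta> g ^ q) ^ q) ^ q * v
     + (((\<beta> g ^ q) ^ q) ^ q) ^ q * u + ((((\<beta> g ^ q) ^ q) ^ q) ^ q) ^ q * u\<^sup>2"
    unfolding tr6_def power_mult_distrib f f' .
  then show ?thesis
    using ev_coords[OF assms(1) g, folded v_def u_def] zero[folded u_def] nz by simp
qed

text \<open>The map \<open>g |-> (\<beta> g, \<gamma> g)\<close> has fibres of at most
  \<open>q\<close> elements and at most \<open>q^7\<close> possible values, so the
  \<open>q^8\<close> functionals must reach every one.\<close>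

lemma coords_surj:
  assumes b: "(((((b ^ q) ^ q) ^ q) ^ q) ^ q) ^ q = b" and c: "c ^ q = c"
  obtains g where "g \<in> dual" "\<beta> g = b" "\<gamma> g = c"
proof -
  define Y where "Y = {x :: 'a alg_closure. x ^ (q ^ 6) = x} \<times> {x :: 'a alg_closure. x ^ q = x}"
  have pow6: "(((((x ^ q) ^ q) ^ q) ^ q) ^ q) ^ q = x ^ (q ^ 6)" for x :: "'a alg_closure"
    by (simp add: eval_nat_numeral power_mult)
  have q6: "1 < q ^ 6" "1 < q"
    using q_ge_4 one_less_power[of q 6] by auto
  have fin: "finite Y"
    unfolding Y_def using q6 by (intro finite_cartesian_product card_power_eq_self)
  have "card Y \<le> q ^ 6 * q"
    unfolding Y_def card_cartesian_product using q6 by (intro mult_mono card_power_eq_self) auto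
  have mem: "(\<beta> g, \<gamma> g) \<in> Y" if "g \<in> dual" for g
    using \<beta>_frob(6)[OF that] \<gamma>_frob[OF that] by (simp add: Y_def pow6)
  have bc: "(b, c) \<in> Y"
    using b c by (simp add: Y_def pow6)
  have "\<exists>g\<in>dual. (\<beta> g, \<gamma> g) = (b, c)"
  proof (rule ccontr)
    assume none: "\<not> ?thesis"
    have "card dual \<le> q * card (Y - {(b, c)})"
    proof (rule card_le_fibres(2)[where f = "\<lambda>g. (\<beta> g, \<gamma> g)"])
      show "(\<beta> g, \<gamma> g) \<in> Y - {(b, c)}" if "g \<in> dual" for g
        using mem none that by blast
      fix y assume "y \<in> Y - {(b, c)}"
      have "card {g \<in> dual. (\<beta> g, \<gamma> g) = y} \<le> card FqF"
      proof (cases "{g \<in> dual. (\<beta> g, \<gamma> g) = y} = {}")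
        case False
        then obtain g0 where g0: "g0 \<in> dual" "(\<beta> g0, \<gamma> g0) = y"
          by blast
        show ?thesis
        proof (rule card_inj_on_le[where f = "\<lambda>g. g - g0"])
          show "(\<lambda>g. g - g0) ` {g \<in> dual. (\<beta> g, \<gamma> g) = y} \<subseteq> FqF"
            using g0 by (auto intro!: kernel_coords_FqF simp: dual_diff \<beta>_diff \<gamma>_diff)
        qed (auto simp: inj_on_def)
      qed (simp only: card.empty le0)
      then show "finite {g \<in> dual. (\<beta> g, \<gamma> g) = y} \<and> card {g \<in> dual. (\<beta> g, \<gamma> g) = y} \<le> q"
        using card_FqF by simp
    qed (use fin in simp)
    then have "q * q ^ 7 \<le> q * card (Y - {(b, c)})"
      by (simp add: card_dual flip: power_Suc)
    then have "q ^ 7 \<le> card (Y - {(b, c)})"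
      using q_ge_4 by simp
    also have "card (Y - {(b, c)}) < card Y"
      using fin bc by (intro psubset_card_mono) auto
    also note \<open>card Y \<le> q ^ 6 * q\<close>
    finally show False
      by (simp add: eval_nat_numeral mult_ac)
  qed
  then show ?thesis
    using that by auto
qed

text \<open>Through \<open>z\<close> the zeros of \<open>F\<close> are all 13th roots of unity. For
  \<open>n\<close> prime to 13 the trace of \<open>\<zeta>^n\<close> depends only on whether
  \<open>n\<close> is a square modulo 13, so a functional can be evaluated explicitly.\<close>

lemma ex_eight_zeros_4:
  assumes q4: "q = 4"
  shows "\<exists>g\<in>dual. g \<notin> FqF \<and> 8 \<le> card {o' \<in> zeros F. ev g o' = 0}"
proof -
  have char2: "x + x = 0" for x :: "'a alg_closure"
  proof -
    obtain k where k: "prime CHAR('a)" "q = CHAR('a) ^ k"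
      by (rule q_char_power)
    then have "k \<noteq> 0"
      using q4 by (metis numeral_One numeral_eq_iff power_0 semiring_norm(83))
    then have "CHAR('a) dvd 2 ^ 2"
      using k(2) q4 dvd_power[of k "CHAR('a)"] by simp
    then have "CHAR('a) = 2"
      using k(1) by (metis prime_dvd_power primes_dvd_imp_eq two_is_prime_nat)
    then have "of_nat 2 = (0 :: 'a alg_closure)"
      by (metis CHAR_alg_closure of_nat_CHAR)
    then have "(2 :: 'a alg_closure) = 0"
      by simp
    then show ?thesis
      by (simp flip: mult_2)
  qed
  have card13: "card (zeros F) = 13"
    using card_zeros_F q4 by simp
  have img: "z ` zeros F = {x. x ^ 13 = 1}"
  proof (rule card_seteq)
    show "finite {x :: 'a alg_closure. x ^ 13 = 1}"
      by (rule card_power_eq) simp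
    show "z ` zeros F \<subseteq> {x. x ^ 13 = 1}"
      using z_power q4 by auto
    show "card {x :: 'a alg_closure. x ^ 13 = 1} \<le> card (z ` zeros F)"
      using card_power_eq(2)[of 13 "1 :: 'a alg_closure"] z_inj card13
      by (simp add: card_image inj_on_subset)
  qed
  have "\<not> z ` zeros F \<subseteq> {1}"
    using card_mono[of "{1}" "z ` zeros F"] card13 z_inj by (auto simp: card_image inj_on_subset)
  then obtain \<zeta> :: "'a alg_closure" where \<zeta>: "\<zeta> ^ 13 = 1" "\<zeta> \<noteq> 1"
    unfolding img by blast
  have red: "\<zeta> ^ m = \<zeta> ^ n" if "m mod 13 = n mod 13" for m n
  proof -
    have "\<zeta> ^ k = \<zeta> ^ (k mod 13)" for k
    proof -
      have "\<zeta> ^ k = (\<zeta> ^ 13) ^ (k div 13) * \<zeta> ^ (k mod 13)"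
        by (simp flip: power_mult power_add)
      then show ?thesis
        by (simp add: \<zeta>)
    qed
    then show ?thesis
      using that by metis
  qed
  have order: "\<zeta> ^ k \<noteq> 1" if "0 < k" "k < 13" for k :: nat
  proof
    assume "\<zeta> ^ k = 1"
    have "k \<in> {1, 2, 3, 4, 5, 6, 7, 8, 9, 10, 11, 12}"
      using that unfolding insert_iff empty_iff by presburger
    \<comment> \<open>By Fermat \<open>k ^ 11\<close> inverts \<open>k\<close> modulo 13.\<close>
    then have "(k * k ^ 11) mod 13 = 1 mod 13"
      by (elim insertE) (simp_all only: , simp_all)
    then have "\<zeta> ^ (k * k ^ 11) = \<zeta> ^ 1"
      by (rule red)
    then show False
      using \<open>\<zeta> ^ k = 1\<close> \<zeta> by (simp add: power_mult)
  qed
  have inj: "inj_on (\<lambda>k. \<zeta> ^ k) {..<13 :: nat}"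
  proof -
    have "i = j" if "i \<le> j" "j < 13" "\<zeta> ^ i = \<zeta> ^ j" for i j :: nat
    proof (rule ccontr)
      assume "i \<noteq> j"
      have "\<zeta> \<noteq> 0"
        using \<zeta>(1) by auto
      have "\<zeta> ^ j = \<zeta> ^ i * \<zeta> ^ (j - i)"
        using that(1) by (simp flip: power_add)
      then have "\<zeta> ^ (j - i) = 1"
        using that \<open>\<zeta> \<noteq> 0\<close> by simp
      then show False
        using order[of "j - i"] that \<open>i \<noteq> j\<close> by simp
    qed
    then show ?thesis
      unfolding inj_on_def by (metis lessThan_iff nle_le)
  qed
  define h where "h n = tr6 (\<zeta> ^ n)" for n :: nat
  \<comment> \<open>The powers of 4 modulo 13 are 1, 4, 3, 12, 9, 10, the nonzero squares.\<close>
  have h: "h n = \<zeta> ^ (n mod 13) + \<zeta> ^ (4 * n mod 13) + \<zeta> ^ (3 * n mod 13) + \<zeta> ^ (12 * n mod 13)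
      + \<zeta> ^ (9 * n mod 13) + \<zeta> ^ (10 * n mod 13)" for n
  proof -
    have "h n = \<zeta> ^ n + \<zeta> ^ (n * 4) + \<zeta> ^ (n * 16) + \<zeta> ^ (n * 64) + \<zeta> ^ (n * 256) + \<zeta> ^ (n * 1024)"
      unfolding h_def tr6_def by (simp add: q4 mult.commute flip: power_mult)
    moreover have red13: "\<zeta> ^ (m + 13 * k) = \<zeta> ^ (m mod 13)" for m k
      by (rule red) simp
    have "\<zeta> ^ n = \<zeta> ^ (n mod 13)" "\<zeta> ^ (n * 4) = \<zeta> ^ (4 * n mod 13)" "\<zeta> ^ (n * 16) = \<zeta> ^ (3 * n mod 13)"
      "\<zeta> ^ (n * 64) = \<zeta> ^ (12 * n mod 13)" "\<zeta> ^ (n * 256) = \<zeta> ^ (9 * n mod 13)"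
      "\<zeta> ^ (n * 1024) = \<zeta> ^ (10 * n mod 13)"
      using red13[of n 0] red13[of "4 * n" 0] red13[of "3 * n" n] red13[of "12 * n" "4 * n"]
        red13[of "9 * n" "19 * n"] red13[of "10 * n" "78 * n"] by (simp_all add: mult.commute)
    ultimately show ?thesis by simp
  qed
  define \<eta> where "\<eta> = h 1"
  define f where "f k = \<zeta> ^ k" for k :: nat
  note h = h[folded f_def]
  \<comment> \<open>Multiplying the exponent by a square permutes the six terms.\<close>
  have h1: "h 1 = \<eta>" "h 3 = \<eta>" "h 4 = \<eta>" "h 9 = \<eta>" "h 10 = \<eta>" "h 12 = \<eta>"
    by (simp_all add: \<eta>_def h add_ac) (simp_all add: eval_nat_numeral)
  \<comment> \<open>The sum of all 13 powers of \<open>\<zeta>\<close> vanishes; it splits into 1,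
    the square exponents and the nonsquare ones.\<close>
  have "\<eta> + h 2 + 1 = 0"
  proof -
    have "(\<zeta> - 1) * (\<Sum>k<13. f k) = \<zeta> ^ 13 - 1"
      unfolding f_def by (rule power_diff_1_eq[symmetric])
    then have "(\<Sum>k<13. f k) = 0"
      using \<zeta> by simp
    moreover have "f 0 = 1"
      by (simp add: f_def)
    moreover have "(\<Sum>k<13. f k) = f 0 + f 1 + f 2 + f 3 + f 4 + f 5 + f 6 + f 7 + f 8 + f 9 + f 10 + f 11 + f 12"
      by (simp add: eval_nat_numeral)
    ultimately show ?thesis
      by (simp add: \<eta>_def h add_ac)
  qed
  moreover have "h 2 + ((\<eta> + 1) + (\<eta> + 1)) = (\<eta> + h 2 + 1) + (\<eta> + 1)"
    by (simp only: add_ac)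
  ultimately have h2: "h 2 = \<eta> + 1"
    by (simp only: char2 add_0_left add_0_right)
  have "h 5 = h 2" "h 6 = h 2" "h 7 = h 2" "h 8 = h 2" "h 11 = h 2"
    by (simp_all add: h add_ac) (simp_all add: eval_nat_numeral)
  note h2 = h2 this[unfolded h2]
  have frob6: "(((((\<zeta> ^ q) ^ q) ^ q) ^ q) ^ q) ^ q = \<zeta>"
    using red[of 4096 1] by (simp add: q4 flip: power_mult)
  have "\<eta> ^ q = \<eta>"
    unfolding \<eta>_def h_def tr6_def power_one_right frob_add_ac frob6 by (simp add: add_ac)
  then have c: "(\<eta> + 1) ^ q = \<eta> + 1"
    by (simp add: frob_add_ac)
  have b: "((((((1 + \<zeta> + \<zeta> ^ 2) ^ q) ^ q) ^ q) ^ q) ^ q) ^ q = 1 + \<zeta> + \<zeta> ^ 2"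
    unfolding power2_eq_square frob_add_ac power_mult_distrib power_one frob6 ..
  \<comment> \<open>The values at the powers of \<open>\<zeta>\<close> form a word of minimum weight 5 in the quadratic residue
    code of length 13 over the field of order 4.\<close>
  obtain g where g: "g \<in> dual" "\<beta> g = 1 + \<zeta> + \<zeta> ^ 2" "\<gamma> g = \<eta> + 1"
    using coords_surj[OF b c] by blast
  have "1 + \<zeta> + \<zeta> ^ 2 \<noteq> 0"
  proof
    assume *: "1 + \<zeta> + \<zeta> ^ 2 = 0"
    have "(\<zeta> - 1) * (1 + \<zeta> + \<zeta> ^ 2) = \<zeta> ^ 3 - 1"
      by (simp add: algebra_simps power2_eq_square power3_eq_cube)
    then have "\<zeta> ^ 3 = 1"
      unfolding * by simp
    then show False
      using order[of 3] by simp
  qed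
  then have "g \<notin> FqF"
    using FqF_coords g by metis
  \<comment> \<open>The value vanishes when an even number of \<open>j\<close>,
    \<open>j + 1\<close>, \<open>j + 2\<close> are squares modulo 13; \<open>J\<close> collects the
    \<open>j\<close> from 1 to 10 with this property.\<close>
  define J where "J = {1, 2, 3, 5, 6, 8, 9, 10 :: nat}"
  have zero: "\<gamma> g + tr6 (\<beta> g * \<zeta> ^ j) = 0" if "j \<in> J" for j
  proof -
    have "\<beta> g * \<zeta> ^ j = \<zeta> ^ j + \<zeta> ^ (j + 1) + \<zeta> ^ (j + 2)"
      by (simp add: g algebra_simps power_add power2_eq_square)
    then have "\<gamma> g + tr6 (\<beta> g * \<zeta> ^ j) = (\<eta> + 1) + h j + h (j + 1) + h (j + 2)"
      by (simp add: g h_def tr6_add add_ac)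
    moreover have x4: "x + x + y + y = 0" "x + y + x + y = 0" "x + y + y + x = 0" for x y :: "'a alg_closure"
      using char2[of x] char2[of y] char2[of "x + y"] by (simp_all add: add_ac)
    have "(\<eta> + 1) + h 1 + h 2 + h 3 = 0" "(\<eta> + 1) + h 2 + h 3 + h 4 = 0" "(\<eta> + 1) + h 3 + h 4 + h 5 = 0"
      "(\<eta> + 1) + h 5 + h 6 + h 7 = 0" "(\<eta> + 1) + h 6 + h 7 + h 8 = 0" "(\<eta> + 1) + h 8 + h 9 + h 10 = 0"
      "(\<eta> + 1) + h 9 + h 10 + h 11 = 0" "(\<eta> + 1) + h 10 + h 11 + h 12 = 0"
      by (simp_all only: h1 h2 x4)
    then have "(\<eta> + 1) + h j + h (j + 1) + h (j + 2) = 0"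
      using that by (auto simp: J_def eval_nat_numeral)
    ultimately show ?thesis by simp
  qed
  have "card ((\<lambda>k. \<zeta> ^ k) ` J) = 8"
    using card_image[of "\<lambda>k. \<zeta> ^ k" J] inj_on_subset[OF inj, of J] by (simp add: J_def)
  moreover have "(\<lambda>k. \<zeta> ^ k) ` J \<subseteq> z ` {o' \<in> zeros F. ev g o' = 0}"
  proof (rule image_subsetI)
    fix j assume j: "j \<in> J"
    have "(\<zeta> ^ j) ^ 13 = 1"
      using \<zeta> by (metis mult.commute power_mult power_one)
    then obtain o' where o': "o' \<in> zeros F" "z o' = \<zeta> ^ j"
      using img by (metis (mono_tags, lifting) imageE mem_Collect_eq)
    then have "ev g o' = 0"
      using zero[OF j] by (intro ev_tr6 g) simp_all
    with o' show "\<zeta> ^ j \<in> z ` {o' \<in> zeros F. ev g o' = 0}"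
      by (metis (mono_tags, lifting) imageI mem_Collect_eq)
  qed
  ultimately have "8 \<le> card (z ` {o' \<in> zeros F. ev g o' = 0})"
    using card_mono[of "z ` {o' \<in> zeros F. ev g o' = 0}" "(\<lambda>k. \<zeta> ^ k) ` J"] by simp
  also have "\<dots> \<le> card {o' \<in> zeros F. ev g o' = 0}"
    by (rule card_image_le) simp
  finally show ?thesis
    using g \<open>g \<notin> FqF\<close> by blast
qed

lemma ex_eight_zeros: "\<exists>g\<in>dual. g \<notin> FqF \<and> 8 \<le> card {o' \<in> zeros F. ev g o' = 0}"
  using ex_eight_zeros_large ex_eight_zeros_4 q_ge_4 by (cases "q = 4") auto

section \<open>The three conditions for the hyperplane section\<close>

definition H :: "(nat \<Rightarrow> 'a) set" where "H = {u \<in> U1 q. lf F u = 0}"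

lemma lin_closed_H: "lin_closed H"
  unfolding H_def using lin_closed_U1 by (rule lin_closed_kernel)

lemma H_subset_U1: "H \<subseteq> U1 q"
  by (auto simp: H_def)

lemma ovec_in_H_iff: "ovec o' \<in> H \<longleftrightarrow> o' \<in> zeros F"
  using ovec_in_U1 by (auto simp: H_def zeros_def ev_def)

lemma pts_in_pts_in: "W \<subseteq> H \<Longrightarrow> pts_in (pts_in (O1 q) H) W = pts_in (O1 q) W"
  by (auto simp: pts_in_def)

text \<open>Five vectors leave at least \<open>q^3\<close> functionals in the annihilator, enough to
  find two that are independent modulo \<open>F\<close>.\<close>

lemma card_pts_in_subspace:
  assumes "W \<subseteq> H" and dim: "fq_subspace_dim q W 5"
  shows "card (pts_in (pts_in (O1 q) H) W) \<le> 6"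
proof -
  obtain vs where vs: "length vs = 5" "set vs \<subseteq> W" "fq_span q vs = W"
    using dim unfolding fq_subspace_dim_def by blast
  have "q ^ 8 \<le> card (annih W) * q ^ 5"
    using card_annih[of vs] annih_span[of vs] vs assms(1) H_subset_U1 by auto
  then have "q ^ 5 * q ^ 3 \<le> q ^ 5 * card (annih W)"
    by (simp add: mult.commute flip: power_add)
  then have "q ^ 3 \<le> card (annih W)"
    using q_ge_4 unfolding mult_le_cancel1 by simp
  moreover have "annih W \<subseteq> dual"
    by (auto simp: annih_def)
  ultimately obtain g1 g2 where g: "g1 \<in> annih W" "g2 \<in> annih W"
    "g1 \<notin> FqF" "\<And>l. l \<in> Fqa \<Longrightarrow> g2 - scale4 l g1 \<notin> FqF"
    using choose_two by blast
  have "{o'. ovec o' \<in> W} \<subseteq> {o' \<in> zeros F. ev g1 o' = 0 \<and> ev g2 o' = 0}"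
    using g(1,2) assms(1) ovec_in_H_iff by (auto simp: annih_def ev_def)
  then have "card {o'. ovec o' \<in> W} \<le> card {o' \<in> zeros F. ev g1 o' = 0 \<and> ev g2 o' = 0}"
    by (intro card_mono) auto
  also have "\<dots> \<le> 6"
    using g by (intro card_common_zeros) (auto simp: annih_def)
  finally show ?thesis
    using fq_subspace_dimD(1)[OF dim] by (simp add: pts_in_pts_in[OF assms(1)] card_pts_in_O1)
qed

text \<open>If the points spanned less, at least \<open>q^2\<close> functionals would annihilate
  them, hence one outside \<open>FqF\<close> would vanish on every zero of \<open>F\<close>.\<close>

lemma pts_in_H_span:
  assumes "card H = q ^ 7"
  shows "\<exists>vs. set vs \<subseteq> \<Union>(pts_in (O1 q) H) \<and> fq_span q vs = H"
proof -
  let ?S = "\<Union>(pts_in (O1 q) H)"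
  have S: "?S \<subseteq> H"
    by (auto simp: pts_in_def)
  have fin: "finite H"
    using finite_subset[OF H_subset_U1 finite_U1] .
  then obtain vs where vs: "set vs \<subseteq> ?S" "fq_indep q vs" "?S \<subseteq> fq_span q vs"
    using fq_basis_exists finite_subset[OF S] by metis
  have sub: "fq_span q vs \<subseteq> H"
    using lin_closed_H vs S by (intro fq_span_subset) auto
  have "fq_span q vs = H"
  proof (rule ccontr)
    assume "fq_span q vs \<noteq> H"
    then have "card (fq_span q vs) < card H"
      using sub fin by (intro psubset_card_mono) auto
    then have "q ^ length vs < q ^ 7"
      using card_fq_span[OF vs(2)] assms by simp
    then have "length vs \<le> 6"
      using q_ge_4 by (simp add: power_strict_increasing_iff)
    then have "q ^ length vs \<le> q ^ 6"
      using q_ge_4 by (intro power_increasing) auto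
    have "q ^ 8 \<le> card (annih (set vs)) * q ^ length vs"
      using card_annih[of vs] vs(1) S H_subset_U1 by blast
    also have "\<dots> \<le> card (annih (set vs)) * q ^ 6"
      using \<open>q ^ length vs \<le> q ^ 6\<close> by simp
    finally have "q ^ 6 * q\<^sup>2 \<le> q ^ 6 * card (annih (set vs))"
      by (simp add: mult.commute flip: power_add)
    then have "q\<^sup>2 \<le> card (annih (set vs))"
      using q_ge_4 unfolding mult_le_cancel1 by simp
    moreover have "q < q\<^sup>2"
      using q_ge_4 by (simp add: power2_eq_square)
    ultimately have "\<not> annih (set vs) \<subseteq> FqF"
      using card_FqF card_mono[of FqF "annih (set vs)"] by auto
    then obtain g where g: "g \<in> annih (fq_span q vs)" "g \<notin> FqF"
      unfolding annih_span by blast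
    have "zeros F \<subseteq> zeros g"
    proof
      fix o' assume "o' \<in> zeros F"
      then have "opoint o' \<in> pts_in (O1 q) H"
        by (simp add: pts_in_O1[OF lin_closed_H] ovec_in_H_iff)
      moreover have "ovec o' \<in> opoint o'"
        using fq_span_superset[of "[ovec o']"] by (simp add: opoint_def)
      ultimately have "ovec o' \<in> fq_span q vs"
        using vs(3) by blast
      then show "o' \<in> zeros g"
        using g by (simp add: zeros_def ev_def annih_def)
    qed
    then show False
      using vanishing_on_zeros g by (simp add: annih_def)
  qed
  with vs(1) show ?thesis by blast
qed

text \<open>The functional with eight zeros cuts out the subspace. By
  \<open>vanishing_on_zeros\<close> it is nonzero somewhere on \<open>H\<close>, so the dimension
  drops by exactly one.\<close>

lemma ex_eight_points:
  assumes "card H = q ^ 7"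
  shows "\<exists>W. W \<subseteq> H \<and> fq_subspace_dim q W 6 \<and> 8 \<le> card (pts_in (pts_in (O1 q) H) W)"
proof -
  obtain g where g: "g \<in> dual" "g \<notin> FqF" "8 \<le> card {o' \<in> zeros F. ev g o' = 0}"
    using ex_eight_zeros by blast
  define W where "W = {u \<in> H. lf g u = 0}"
  have W: "lin_closed W" "W \<subseteq> H"
    unfolding W_def using lin_closed_kernel[OF lin_closed_H] by auto
  have "\<not> zeros F \<subseteq> zeros g"
    using vanishing_on_zeros g by blast
  then obtain o1 where "ovec o1 \<in> H" "lf g (ovec o1) \<noteq> 0"
    using ovec_in_H_iff by (auto simp: zeros_def ev_def)
  then have "card H = card W * q"
    unfolding W_def using lin_closed_H H_subset_U1 g by (intro card_kernel)
  then have "q * card W = q * q ^ 6"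
    using assms by (simp add: mult.commute flip: power_Suc)
  then have "card W = q ^ 6"
    using q_ge_4 unfolding mult_cancel1 by simp
  moreover have "finite W"
    using finite_subset[OF W(2) finite_subset[OF H_subset_U1 finite_U1]] .
  ultimately have "fq_subspace_dim q W 6"
    using W by (intro fq_subspace_dimI)
  moreover have "{o'. ovec o' \<in> W} = {o' \<in> zeros F. ev g o' = 0}"
    by (auto simp: W_def ovec_in_H_iff ev_def)
  ultimately show ?thesis
    using g(3) W by (intro exI[of _ W]) (simp add: pts_in_pts_in card_pts_in_O1)
qed

lemma rs_set_H:
  assumes "card H = q ^ 7"
  shows "rs_set q 6 4 H (pts_in (O1 q) H)"
  unfolding rs_set_def
  using card_pts_in_subspace pts_in_H_span[OF assms] ex_eight_points[OF assms] by simp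

end

theorem mainTheorem11:
  fixes q :: nat and H1 :: "(nat \<Rightarrow> 'a::{finite,field}) set"
  assumes "\<exists>p k. prime p \<and> k > 0 \<and> q = p ^ k"
    and "card (UNIV :: 'a set) = q ^ 3"
    and "q \<ge> 4"
    and "H1 \<subseteq> U1 q" and "fq_subspace_dim q H1 7"
    and "card (pts_in (O1 q) H1) = q^2 - q + 1"
  shows "rs_set q 6 4 H1 (pts_in (O1 q) H1)"
proof -
  interpret cubic_extension q "TYPE('a)"
    using assms(1-3) by unfold_locales
  obtain F where F: "F \<in> dual" "H1 = {u \<in> U1 q. lf F u = 0}"
    using hyperplane_is_kernel[OF assms(4,5)] by metis
  have "{o'. ovec o' \<in> H1} = zeros F"
    using ovec_in_U1 by (auto simp: F(2) zeros_def ev_def)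
  then have "card (zeros F) = q\<^sup>2 - q + 1"
    using assms(6) card_pts_in_O1[OF fq_subspace_dimD(1)[OF assms(5)]] by simp
  then obtain p r Z o0 where "elliptic q F p r Z o0"
    using ex_elliptic F(1) by blast
  then interpret elliptic q "TYPE('a)" F p r Z o0 .
  show ?thesis
    using rs_set_H fq_subspace_dimD(3)[OF assms(5)] unfolding H_def F(2)[symmetric] .
qed

end
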